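(* Let $n\ge2$. The total number of $\varphi$-orbits of $\mathcal I_n$ is $$\frac{1}{n-1}\sum_{d\mid (n-1)}\phi\bigl((n-1)/d\bigr)\,(F_{d-1}+F_{d+1}),$$ where $\phi$ is Euler's totient function. The total number of reversible $\varphi$-orbits of $\mathcal I_n$ is $F_{\lceil n/2\rceil+1}$.
   Context: $F_k$ denotes the Fibonacci numbers: $F_0=0$, $F_1=1$, $F_k=F_{k-1}+F_{k-2}$ for $k\ge2$. $[n]=\{1,\dots,n\}$. $\mathcal I_n$ is the set of independent sets of the path graph on $[n]$, i.e. subsets $S\subseteq[n]$ containing no two consecutive integers. For $i\in[n]$ the toggle $\tau_i:\mathcal I_n\to\mathcal I_n$ is defined by: $\tau_i(S)=S\setminus\{i\}$ if $i\in S$; $\tau_i(S)=S\cup\{i\}$ if $i\notin S$ and $S\cup\{i\}\in\mathcal I_n$; and $\tau_i(S)=S$ otherwise. $\varphi=\tau_n\cdots\tau_2\tau_1$, composed from right to left ($\tau_1$ is applied first). The reverse of $S\in\mathcal I_n$ is $S^{\mathrm{rev}}=\{n+1-i : i\in S\}$. A $\varphi$-orbit $\mathcal O$ is reversible if for some $S\in\mathcal O$ one has $S^{\mathrm{rev}}\in\mathcal O$. *)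

theory Defs
  imports
    Complex_Main
    "HOL-Combinatorics.Orbits"
    "HOL-Number_Theory.Fib"
    "HOL-Number_Theory.Totient"
begin

definition indep_sets :: "nat \<Rightarrow> nat set set" where
  "indep_sets n = {S. S \<subseteq> {1..n} \<and> (\<forall>i. \<not> (i \<in> S \<and> Suc i \<in> S))}"

text \<open>
  The toggles are total functions on sets of naturals; only their restrictions to
  \<open>indep_sets n\<close> matter, and these map \<open>indep_sets n\<close> to itself (see below).
\<close>

definition toggle :: "nat \<Rightarrow> nat \<Rightarrow> nat set \<Rightarrow> nat set" where
  "toggle n i S =
     (if i \<in> S then S - {i}
      else if insert i S \<in> indep_sets n then insert i S
      else S)"

text \<open>\<open>fold\<close> processes the list from the left, so \<open>toggle n 1\<close> is applied first.\<close>

definition phi :: "nat \<Rightarrow> nat set \<Rightarrow> nat set" where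
  "phi n S = fold (toggle n) [1..<Suc n] S"

text \<open>
  \<open>orbit f x\<close> is the forward orbit, starting with \<open>f x\<close>. As \<open>phi n\<close> permutes the finite
  set \<open>indep_sets n\<close> (see below), this is the usual orbit and contains \<open>x\<close>.
\<close>

definition phi_orbits :: "nat \<Rightarrow> nat set set set" where
  "phi_orbits n = orbit (phi n) ` indep_sets n"

definition reverse_set :: "nat \<Rightarrow> nat set \<Rightarrow> nat set" where
  "reverse_set n S = (\<lambda>i. n + 1 - i) ` S"

definition reversible :: "nat \<Rightarrow> nat set set \<Rightarrow> bool" where
  "reversible n A \<longleftrightarrow> (\<exists>S\<in>A. reverse_set n S \<in> A)"

lemma finite_indep_sets: "finite (indep_sets n)"
  by (rule finite_subset[of _ "Pow {1..n}"]) (auto simp: indep_sets_def)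

lemma toggle_closed: "S \<in> indep_sets n \<Longrightarrow> toggle n i S \<in> indep_sets n"
  by (auto simp: toggle_def indep_sets_def)

lemma toggle_toggle: "S \<in> indep_sets n \<Longrightarrow> toggle n i (toggle n i S) = S"
  by (auto simp: toggle_def insert_absorb)

lemma bij_betw_toggle: "bij_betw (toggle n i) (indep_sets n) (indep_sets n)"
  by (rule bij_betw_byWitness[of _ "toggle n i"])
    (auto simp: toggle_closed toggle_toggle)

lemma bij_betw_phi: "bij_betw (phi n) (indep_sets n) (indep_sets n)"
proof -
  have "bij_betw (fold (toggle n) xs) (indep_sets n) (indep_sets n)" for xs
  proof (induction xs)
    case Nil
    show ?case by (simp add: bij_betw_def inj_on_def)
  next
    case (Cons i xs)
    show ?case
      unfolding fold_Cons by (rule bij_betw_trans[OF bij_betw_toggle Cons.IH])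
  qed
  then show ?thesis
    unfolding phi_def[abs_def] .
qed

lemma phi_orbit_self:
  assumes "S \<in> indep_sets n"
  shows "S \<in> orbit (phi n) S"
proof -
  have bij: "bij_betw (phi n ^^ k) (indep_sets n) (indep_sets n)" for k
    by (rule bij_betw_funpow[OF bij_betw_phi])
  then have closed: "(phi n ^^ k) S \<in> indep_sets n" for k
    using assms bij_betwE by blast
  have "finite (range (\<lambda>k. (phi n ^^ k) S))"
    by (rule finite_subset[OF _ finite_indep_sets[of n]]) (auto simp: closed)
  then have "\<not> inj (\<lambda>k. (phi n ^^ k) S)"
    using finite_imageD infinite_UNIV_nat by blast
  then obtain j k where "j < k" and eq: "(phi n ^^ j) S = (phi n ^^ k) S"
    unfolding inj_def by (metis linorder_neqE_nat)
  have "(phi n ^^ j) S = (phi n ^^ j) ((phi n ^^ (k - j)) S)"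
    using \<open>j < k\<close> eq funpow_add[of j "k - j" "phi n"] by simp
  then have "S = (phi n ^^ (k - j)) S"
    using bij[of j] closed assms by (meson bij_betw_imp_inj_on inj_onD)
  with \<open>j < k\<close> show ?thesis
    unfolding orbit_altdef by (metis (mono_tags, lifting) mem_Collect_eq zero_less_diff)
qed

end

theory Submission
  imports Defs
begin

text \<open>
  Write the successive images of a set under the toggle map as the rows of a board. From every
  occupied cell \<open>(t, i)\<close> outside the last column exactly one of \<open>(t, i + 2)\<close> and \<open>(t + 1, i + 1)\<close>
  is occupied, so the occupied cells form snakes running from the first to the last column, and a
  snake is a composition of \<open>m = n - 1\<close> into parts 1 and 2. Consecutive snakes differ by
  a rotation of the parts. Hence an orbit is the same thing as an \<open>m\<close>-periodic set
  \<open>P\<close> of integers (the partial sums) with gaps 1 and 2, up to translation, and time reversal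
  together with reversal of the rows becomes \<open>P \<mapsto> -P\<close>.
  Burnside's lemma for the rotations counts all classes; counting the pairs of a set \<open>P\<close> and a
  reflection fixing it counts the reversible ones, since each reversible class contributes
  exactly \<open>m\<close> such pairs.
\<close>

subsection \<open>The board of a cut set\<close>

text \<open>No snake is ever traced inside a given orbit: the argument runs in the opposite
  direction. The board is written down in closed form from \<open>P\<close>, and its rows are shown
  to obey the local rule of one sweep of toggles; since \<open>phi\<close> is deterministic, the
  rows then form an orbit. The rule has two halves. Exclusion holds because, within a column, a
  later snake lies at least two rows below an earlier one. Covering, that an empty cell always has
  an occupied cell to blame, is a discrete crossing argument, and this is where periodicity enters:
  a snake has total length \<open>m\<close>, so at both border columns the two positions compared
  are cut points simultaneously. That every orbit arises from a board is obtained by comparing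
  cardinalities, not by decomposing orbits.\<close>

definition cut_sets :: "int \<Rightarrow> int set set" where
  "cut_sets m = {P. (\<forall>x. x + m \<in> P \<longleftrightarrow> x \<in> P) \<and> (\<forall>x. x \<in> P \<or> x + 1 \<in> P)}"

text \<open>The sign makes this a counting function on all of the integers: for x < y its increase
  from x to y is the number of cut points in the half-open interval (x, y].\<close>

definition cut_count :: "int set \<Rightarrow> int \<Rightarrow> int" where
  "cut_count P x = (if 0 \<le> x then int (card (P \<inter> {0<..x})) else - int (card (P \<inter> {x<..0})))"

text \<open>
  Let \<open>p j\<close> be the cut point with \<open>cut_count P (p j) = j\<close>. Snake \<open>j\<close> is the one whose first part ends
  at \<open>p (j + 1)\<close>. Part 1 leads one row down and one column to the right, part 2 two columns to the
  right, and a snake starting with part \<open>d\<close> is followed by the next snake after \<open>4 - d\<close> rows. So snake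
  \<open>j\<close> starts in row \<open>4 * j - p j\<close> and meets column \<open>1 + p l - p j\<close> in row \<open>2 * j + 2 * l - p l\<close>.
\<close>

definition cell_time :: "int set \<Rightarrow> int \<Rightarrow> int \<Rightarrow> int" where
  "cell_time P a b = 2 * cut_count P a + 2 * cut_count P b - b"

text \<open>The index \<open>s\<close> of a cell is its column number minus 1.\<close>

definition cell :: "int set \<Rightarrow> int \<Rightarrow> int \<Rightarrow> bool" where
  "cell P t s \<longleftrightarrow> (\<exists>a. a \<in> P \<and> a + s \<in> P \<and> cell_time P a (a + s) = t)"

definition row :: "nat \<Rightarrow> int set \<Rightarrow> int \<Rightarrow> nat set" where
  "row m P t = {i \<in> {1..m+1}. cell P t (int i - 1)}"

section \<open>Growth of the counting function and of cell times\<close>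

lemma cut_sets_periodic: "P \<in> cut_sets m \<Longrightarrow> x + m \<in> P \<longleftrightarrow> x \<in> P"
  by (simp add: cut_sets_def)

lemma cut_sets_cover: "P \<in> cut_sets m \<Longrightarrow> x \<in> P \<or> x + 1 \<in> P"
  by (simp add: cut_sets_def)

lemma cut_count_0 [simp]: "cut_count P 0 = 0"
  by (simp add: cut_count_def)

lemma cut_count_add1: "cut_count P (x + 1) = cut_count P x + (if x + 1 \<in> P then 1 else 0)"
proof (cases "0 \<le> x")
  case True
  then have "{0<..x + 1} = insert (x + 1) {0<..x}" by auto
  with True show ?thesis by (simp add: cut_count_def)
next
  case False
  then have *: "{x<..0} = insert (x + 1) {x + 1<..0}" by auto
  from False have "x + 1 \<le> 0" by simp
  show ?thesis
  proof (cases "x + 1 = 0")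
    case True
    then have "{x<..0} = {0}" by auto
    with True False show ?thesis by (simp add: cut_count_def)
  next
    case f: False
    with False have "x + 1 < 0" by simp
    then show ?thesis using False by (simp add: cut_count_def *)
  qed
qed

text \<open>Gives the counting functions of translates and negatives by comparing increments,
  without handling cardinalities again.\<close>

lemma cut_count_unique:
  assumes "\<And>x. f (x + 1) = f x + (if x + 1 \<in> P then 1 else 0)"
  shows "f x = f 0 + cut_count P x"
proof (induction x rule: int_induct[where k = 0])
  case (step1 i)
  then show ?case using assms[of i] cut_count_add1[of P i] by simp
next
  case (step2 i)
  then show ?case using assms[of "i - 1"] cut_count_add1[of P "i - 1"] by simp
qed simp

text \<open>At least one of any two neighbours is a cut point. The correction term covers a walk
  that ends on a skipped integer, whose cut point comes only one step later.\<close>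

lemma cut_count_growth:
  assumes P: "P \<in> cut_sets m" and "a \<in> P"
  shows "int k - (if a + int k \<in> P then 0 else 1) \<le> 2 * (cut_count P (a + int k) - cut_count P a)"
proof (induction k)
  case 0
  then show ?case using assms by simp
next
  case (Suc k)
  have "cut_count P (a + int (Suc k)) = cut_count P (a + int k) + (if a + int (Suc k) \<in> P then 1 else 0)"
    using cut_count_add1[of P "a + int k"] by (simp add: algebra_simps)
  moreover have "a + int k \<in> P \<or> a + int (Suc k) \<in> P"
    using cut_sets_cover[OF P, of "a + int k"] by (simp add: algebra_simps)
  ultimately show ?case using Suc.IH by (auto split: if_splits)
qed

lemma cut_count_mono: "a \<le> b \<Longrightarrow> cut_count P a \<le> cut_count P b"
proof (induction b rule: int_ge_induct)
  case (step i)
  then show ?case using cut_count_add1[of P i] by auto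
qed simp

lemma cut_count_strict_mono:
  assumes "a < b" "b \<in> P"
  shows "cut_count P a + 1 \<le> cut_count P b"
  using cut_count_mono[of a "b - 1" P] cut_count_add1[of P "b - 1"] assms by simp

text \<open>Along a snake this quantity is the row up to a constant: a gap of 1 raises it by 2 - 1,
  a gap of 2 by 2 - 2. Snakes therefore never move upwards.\<close>

lemma drift_mono:
  assumes P: "P \<in> cut_sets m" and "a \<in> P" "b \<in> P" "a \<le> b"
  shows "2 * cut_count P a - a \<le> 2 * cut_count P b - b"
  using cut_count_growth[OF P \<open>a \<in> P\<close>, of "nat (b - a)"] assms by simp

lemma cell_time_mono:
  assumes "P \<in> cut_sets m" "b \<in> P" "b' \<in> P" "a \<le> a'" "b \<le> b'"
  shows "cell_time P a b \<le> cell_time P a' b'"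
  using drift_mono[OF assms(1-3,5)] cut_count_mono[OF assms(4), of P] by (simp add: cell_time_def)

text \<open>The next cut point as starting point costs a full 2, and this slack is what rules out
  collisions between neighbouring cells of different snakes.\<close>

lemma cell_time_strict_mono:
  assumes "P \<in> cut_sets m" "a' \<in> P" "b \<in> P" "b' \<in> P" "a < a'" "b \<le> b'"
  shows "cell_time P a b + 2 \<le> cell_time P a' b'"
  using drift_mono[OF assms(1,3,4,6)] cut_count_strict_mono[OF assms(5,2)] by (simp add: cell_time_def)

section \<open>Occupied cells and the sweep rule\<close>

text \<open>Cells of different snakes are two rows too far apart; on a single snake, the next column
  can only be entered by a part 1, which also moves one row down.\<close>

lemma not_cell_right:
  assumes P: "P \<in> cut_sets m" and "cell P t s"
  shows "\<not> cell P t (s + 1)"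
proof
  assume "cell P t (s + 1)"
  then obtain a where a: "a \<in> P" "a + (s + 1) \<in> P" "cell_time P a (a + (s + 1)) = t"
    by (auto simp: cell_def)
  obtain c where c: "c \<in> P" "c + s \<in> P" "cell_time P c (c + s) = t"
    using assms(2) by (auto simp: cell_def)
  consider "a < c" | "a = c" | "c < a" by linarith
  then show False
  proof cases
    case 1
    then show ?thesis using cell_time_strict_mono[OF P c(1) a(2) c(2), of a] a c by simp
  next
    case 2
    then show ?thesis using cut_count_add1[of P "c + s"] a c by (simp add: cell_time_def algebra_simps)
  next
    case 3
    then show ?thesis using cell_time_strict_mono[OF P a(1) c(2) a(2), of c] a c by simp
  qed
qed

lemma not_cell_below:
  assumes P: "P \<in> cut_sets m" and "cell P t s"
  shows "\<not> cell P (t + 1) s"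
proof
  assume "cell P (t + 1) s"
  then obtain a where a: "a \<in> P" "a + s \<in> P" "cell_time P a (a + s) = t + 1"
    by (auto simp: cell_def)
  obtain c where c: "c \<in> P" "c + s \<in> P" "cell_time P c (c + s) = t"
    using assms(2) by (auto simp: cell_def)
  show False
  proof (cases "c < a")
    case True
    then show ?thesis using cell_time_strict_mono[OF P a(1) c(2) a(2), of c] a c by simp
  next
    case False
    then show ?thesis using cell_time_mono[OF P a(2) c(2), of a c] a c by simp
  qed
qed

text \<open>This diagonal pair conflicts because a sweep goes from left to right: when a column is
  toggled, its right neighbour still belongs to the old row.\<close>

lemma not_cell_below_left:
  assumes P: "P \<in> cut_sets m" and "cell P t (s + 1)"
  shows "\<not> cell P (t + 1) s"
proof
  assume "cell P (t + 1) s"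
  then obtain a where a: "a \<in> P" "a + s \<in> P" "cell_time P a (a + s) = t + 1"
    by (auto simp: cell_def)
  obtain c where c: "c \<in> P" "c + (s + 1) \<in> P" "cell_time P c (c + (s + 1)) = t"
    using assms(2) by (auto simp: cell_def)
  show False
  proof (cases "c < a")
    case True
    then show ?thesis using cell_time_strict_mono[OF P a(1) c(2) a(2), of c] a c by simp
  next
    case False
    then show ?thesis using cell_time_mono[OF P a(2) c(2), of a c] a c by simp
  qed
qed

text \<open>A discrete intermediate value argument. Growth is assumed over two steps only, because
  the function it is applied to can drop by 1 in a single step.\<close>

lemma int_crossing:
  fixes f :: "int \<Rightarrow> int"
  assumes grow: "\<And>a. f a + 2 \<le> f (a + 2)"
  obtains a where "f a \<le> t" "t < f (a + 1)"
proof -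
  have up: "f a + 2 * int k \<le> f (a + 2 * int k)" for a k
  proof (induction k)
    case (Suc k)
    then show ?case using grow[of "a + 2 * int k"] by (simp add: algebra_simps)
  qed simp
  define k where "k = nat (\<bar>f 0\<bar> + \<bar>t\<bar> + 1)"
  have "f (- 2 * int k) + 2 * int k \<le> f 0"
    using up[of "- 2 * int k" k] by simp
  then have low: "f (- 2 * int k) \<le> t" by (simp add: k_def)
  have high: "t < f (2 * int k)" using up[of 0 k] by (simp add: k_def)
  show thesis
  proof (rule ccontr)
    assume "\<not> thesis"
    then have step: "f a \<le> t \<Longrightarrow> f (a + 1) \<le> t" for a
      using that linorder_not_le by blast
    have "f x \<le> t" if "- 2 * int k \<le> x" for x
      using that by (induction x rule: int_ge_induct) (use low step in auto)
    from this[of "2 * int k"] high show False by simp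
  qed
qed

text \<open>\<open>cell_time P a (a + s)\<close> is followed through all integers \<open>a\<close>,
  whether or not they are cut points. Where it passes \<open>t\<close>, the cut points among
  \<open>a\<close>, \<open>a + s\<close> and their neighbours always produce one of the four
  cells.\<close>

lemma cell_cover:
  assumes P: "P \<in> cut_sets m" and "0 < m" "0 \<le> s" "s \<le> m"
  shows "cell P (t + 1) s \<or> cell P t s \<or> (0 < s \<and> cell P (t + 1) (s - 1)) \<or> (s < m \<and> cell P t (s + 1))"
proof -
  have step: "cell_time P (a + 1) (a + 1 + s) = cell_time P a (a + s) - 1
      + (if a + 1 \<in> P then 2 else 0) + (if a + s + 1 \<in> P then 2 else 0)" for a
    using cut_count_add1[of P a] cut_count_add1[of P "a + s"] by (simp add: cell_time_def algebra_simps)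
  obtain a where a: "cell_time P a (a + s) \<le> t" "t < cell_time P (a + 1) (a + 1 + s)"
  proof (rule int_crossing)
    \<comment> \<open>A single step adds -1, 1 or 3. In two steps each of the two positions meets a
      cut point at least once, so the total is at least -2 + 2 + 2.\<close>
    show "cell_time P a (a + s) + 2 \<le> cell_time P (a + 2) (a + 2 + s)" for a
      using step[of a] step[of "a + 1"] cut_sets_cover[OF P, of "a + 1"]
        cut_sets_cover[OF P, of "a + s + 1"] by (auto simp: algebra_simps split: if_splits)
  qed
  define b where "b = a + s"
  have sb: "s = b - a" by (simp add: b_def)
  have cellI: "cell P u v" if "c \<in> P" "d \<in> P" "cell_time P c d = u" "v = d - c" for c d u v
    using that unfolding cell_def by (intro exI[of _ c]) auto
  have cell_iff: "cell P u (d - c)" if "c \<in> P" "d \<in> P" "2 * cut_count P c + 2 * cut_count P d - d = u" for c d u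
    using that by (intro cellI[of c d]) (auto simp: cell_time_def)
  note N = cut_count_add1[of P a] cut_count_add1[of P b] cut_count_add1[of P "a - 1"] cut_count_add1[of P "b - 1"]
  have cov: "a \<in> P \<or> a + 1 \<in> P" "b \<in> P \<or> b + 1 \<in> P" "a - 1 \<in> P \<or> a \<in> P" "b - 1 \<in> P \<or> b \<in> P"
    using cut_sets_cover[OF P, of a] cut_sets_cover[OF P, of b]
      cut_sets_cover[OF P, of "a - 1"] cut_sets_cover[OF P, of "b - 1"] by auto
  \<comment> \<open>In the border columns the two positions coincide or differ by one period, so
    they are cut points together; this excludes a blame on a cell outside the board.\<close>
  have s0: "s = 0 \<Longrightarrow> b = a" and sm: "s = m \<Longrightarrow> (b \<in> P \<longleftrightarrow> a \<in> P) \<and> (b + 1 \<in> P \<longleftrightarrow> a + 1 \<in> P)"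
    using cut_sets_periodic[OF P, of a] cut_sets_periodic[OF P, of "a + 1"]
    by (auto simp: b_def algebra_simps)
  have f: "2 * cut_count P a + 2 * cut_count P b - b \<le> t" "t < 2 * cut_count P (a + 1) + 2 * cut_count P (b + 1) - (b + 1)"
    using a by (auto simp: cell_time_def b_def algebra_simps)
  note I = cell_iff[of a b] cell_iff[of "a + 1" "b + 1"] cell_iff[of "a + 1" b] cell_iff[of a "b + 1"]
    cell_iff[of "a - 1" b] cell_iff[of a "b - 1"] cell_iff[of "a - 1" "b - 1"]
  have shapes: "b - a = s" "b + 1 - (a + 1) = s" "b - (a + 1) = s - 1" "b + 1 - a = s + 1"
    "b - (a - 1) = s + 1" "b - 1 - a = s - 1" "b - 1 - (a - 1) = s"
    by (auto simp: b_def)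
  note J = I[unfolded shapes]
  show ?thesis
    using J N cov s0 sm f assms(2-4) by (smt (verit))
qed

lemma row_step:
  assumes P: "P \<in> cut_sets (int m)" and "0 < m" and i: "i \<in> {1..m+1}"
  shows "i \<in> row m P (t + 1) \<longleftrightarrow> i \<notin> row m P t \<and> i - 1 \<notin> row m P (t + 1) \<and> i + 1 \<notin> row m P t"
proof -
  define s where "s = int i - 1"
  have s: "0 \<le> s" "s \<le> int m" using i by (auto simp: s_def)
  have 1: "i \<in> row m P u \<longleftrightarrow> cell P u s" for u
    using i by (auto simp: row_def s_def)
  \<comment> \<open>For \<open>i = 1\<close> the left neighbour is column 0, which lies in no row;
    the condition \<open>0 < s\<close> records this.\<close>
  have 2: "i - 1 \<in> row m P u \<longleftrightarrow> 0 < s \<and> cell P u (s - 1)" for u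
    using i by (auto simp: row_def s_def of_nat_diff)
  have 3: "i + 1 \<in> row m P u \<longleftrightarrow> s < m \<and> cell P u (s + 1)" for u
    using i by (auto simp: row_def s_def of_nat_diff)
  show ?thesis
    unfolding 1 2 3
    using cell_cover[OF P _ s, of t] not_cell_below[OF P, of t s]
      not_cell_below_left[OF P, of t s] not_cell_right[OF P, of "t + 1" "s - 1"] \<open>0 < m\<close>
    by auto
qed

lemma row_indep:
  assumes P: "P \<in> cut_sets (int m)"
  shows "row m P t \<in> indep_sets (m + 1)"
  using not_cell_right[OF P, of t] by (auto simp: indep_sets_def row_def) (metis diff_add_cancel of_nat_Suc add.commute add_diff_cancel_left')

text \<open>After \<open>k\<close> toggles the set agrees with \<open>T\<close> up to column
  \<open>k\<close> and with \<open>S\<close> beyond, so toggling the next column sees a new left and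
  an old right neighbour, exactly as in the rule.\<close>

lemma phi_eqI:
  assumes S: "S \<in> indep_sets n" and T: "T \<subseteq> {1..n}"
    and rule: "\<And>i. i \<in> {1..n} \<Longrightarrow> i \<in> T \<longleftrightarrow> i \<notin> S \<and> i - 1 \<notin> T \<and> i + 1 \<notin> S"
  shows "phi n S = T"
proof -
  have "fold (toggle n) [1..<Suc k] S = (T \<inter> {1..k}) \<union> (S \<inter> {k<..})" if "k \<le> n" for k
    using that
  proof (induction k)
    case 0
    then show ?case using S by (auto simp: indep_sets_def)
  next
    case (Suc k)
    define U where "U = (T \<inter> {1..k}) \<union> (S \<inter> {k<..})"
    have "U \<in> indep_sets n"
    proof -
      have "\<not> (i \<in> U \<and> Suc i \<in> U)" for i
        using S rule[of i] rule[of "Suc i"] T by (cases "i \<le> k"; cases "Suc i \<le> k") (auto simp: U_def indep_sets_def)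
      moreover have "U \<subseteq> {1..n}" using S T by (auto simp: U_def indep_sets_def)
      ultimately show ?thesis by (simp add: indep_sets_def)
    qed
    have mem: "Suc k \<in> U \<longleftrightarrow> Suc k \<in> S" "k \<in> U \<longleftrightarrow> k \<in> T" "Suc (Suc k) \<in> U \<longleftrightarrow> Suc (Suc k) \<in> S"
      using T by (auto simp: U_def)
    have ins: "insert (Suc k) U \<in> indep_sets n \<longleftrightarrow> k \<notin> U \<and> Suc (Suc k) \<notin> U" if "Suc k \<notin> U"
      using \<open>U \<in> indep_sets n\<close> \<open>Suc k \<le> n\<close> that by (auto simp: indep_sets_def)
    have "toggle n (Suc k) U = (T \<inter> {1..Suc k}) \<union> (S \<inter> {Suc k<..})"
    proof -
      have in_T: "Suc k \<in> T \<longleftrightarrow> Suc k \<notin> S \<and> k \<notin> T \<and> Suc (Suc k) \<notin> S"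
        using rule[of "Suc k"] \<open>Suc k \<le> n\<close> by simp
      have "x \<in> toggle n (Suc k) U \<longleftrightarrow> x \<in> (T \<inter> {1..Suc k}) \<union> (S \<inter> {Suc k<..})" for x
      proof (cases "x = Suc k")
        case True
        then show ?thesis using mem ins in_T by (auto simp: toggle_def)
      next
        case False
        then have "x \<in> toggle n (Suc k) U \<longleftrightarrow> x \<in> U" by (auto simp: toggle_def)
        also have "\<dots> \<longleftrightarrow> x \<in> (T \<inter> {1..Suc k}) \<union> (S \<inter> {Suc k<..})"
          using False by (auto simp: U_def)
        finally show ?thesis .
      qed
      then show ?thesis by blast
    qed
    with Suc show ?case by (simp add: U_def)
  qed
  from this[of n] show ?thesis
    using S T by (auto simp: phi_def indep_sets_def)
qed

lemma phi_row:
  assumes "P \<in> cut_sets (int m)" "0 < m"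
  shows "phi (m + 1) (row m P t) = row m P (t + 1)"
  using assms by (intro phi_eqI row_indep row_step) (auto simp: row_def)

lemma funpow_phi_row:
  assumes "P \<in> cut_sets (int m)" "0 < m"
  shows "(phi (m + 1) ^^ k) (row m P t) = row m P (t + int k)"
proof (induction k)
  case (Suc k)
  then show ?case using phi_row[OF assms, of "t + int k"] by (simp add: algebra_simps)
qed simp

subsection \<open>Toggle orbits as necklaces\<close>

definition translate :: "int \<Rightarrow> int set \<Rightarrow> int set" where
  "translate k P = {x. x + k \<in> P}"

definition negate :: "int set \<Rightarrow> int set" where
  "negate P = {x. - x \<in> P}"

definition necklace :: "int set \<Rightarrow> int set set" where
  "necklace P = range (\<lambda>k. translate k P)"

definition board_orbit :: "nat \<Rightarrow> int set \<Rightarrow> nat set set" where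
  "board_orbit m P = range (row m P)"

lemma translate_0 [simp]: "translate 0 P = P"
  by (simp add: translate_def)

lemma translate_translate [simp]: "translate j (translate k P) = translate (j + k) P"
  by (simp add: translate_def algebra_simps)

lemma translate_eq_iff: "translate j P = translate k Q \<longleftrightarrow> translate (j - k) P = Q"
proof
  assume "translate j P = translate k Q"
  then have "translate (- k) (translate j P) = translate (- k) (translate k Q)" by simp
  then show "translate (j - k) P = Q" by simp
next
  assume "translate (j - k) P = Q"
  then show "translate j P = translate k Q" by auto
qed

lemma negate_translate: "negate (translate k P) = translate (- k) (negate P)"
  by (simp add: translate_def negate_def)

lemma translate_cut_sets:
  assumes P: "P \<in> cut_sets m"
  shows "translate k P \<in> cut_sets m"
proof -
  have "x + m + k \<in> P \<longleftrightarrow> x + k \<in> P" for x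
    using cut_sets_periodic[OF P, of "x + k"] by (simp add: algebra_simps)
  moreover have "x + k \<in> P \<or> x + 1 + k \<in> P" for x
    using cut_sets_cover[OF P, of "x + k"] by (simp add: algebra_simps)
  ultimately show ?thesis by (simp add: cut_sets_def translate_def)
qed

lemma negate_cut_sets: 
  assumes P: "P \<in> cut_sets m"
  shows "negate P \<in> cut_sets m"
proof -
  have "- (x + m) \<in> P \<longleftrightarrow> - x \<in> P" for x
    using cut_sets_periodic[OF P, of "- (x + m)"] by simp
  moreover have "- x \<in> P \<or> - (x + 1) \<in> P" for x
    using cut_sets_cover[OF P, of "- (x + 1)"] by auto
  ultimately show ?thesis by (simp add: cut_sets_def negate_def)
qed

lemma translate_period: "P \<in> cut_sets m \<Longrightarrow> translate m P = P"
  by (simp add: translate_def cut_sets_periodic)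

lemma cut_sets_periodic_mult:
  assumes P: "P \<in> cut_sets m"
  shows "x + k * m \<in> P \<longleftrightarrow> x \<in> P"
proof (induction k rule: int_induct[where k = 0])
  case (step1 i)
  then show ?case using cut_sets_periodic[OF P, of "x + i * m"] by (simp add: algebra_simps)
next
  case (step2 i)
  then show ?case using cut_sets_periodic[OF P, of "x + (i - 1) * m"] by (simp add: algebra_simps)
qed simp

lemma cut_sets_mod:
  assumes P: "P \<in> cut_sets m"
  shows "x mod m \<in> P \<longleftrightarrow> x \<in> P"
  using cut_sets_periodic_mult[OF P, of "x mod m" "x div m"] by (simp add: algebra_simps)

lemma finite_cut_sets:
  assumes "0 < m"
  shows "finite (cut_sets m)"
proof (rule inj_on_finite[of "\<lambda>P. P \<inter> {0..<m}" _ "Pow {0..<m}"])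
  show "inj_on (\<lambda>P. P \<inter> {0..<m}) (cut_sets m)"
  proof (rule inj_onI)
    fix P Q assume P: "P \<in> cut_sets m" and Q: "Q \<in> cut_sets m"
      and eq: "P \<inter> {0..<m} = Q \<inter> {0..<m}"
    have "x \<in> P \<longleftrightarrow> x \<in> Q" for x
    proof -
      have "x mod m \<in> {0..<m}" using assms by simp
      with eq have "x mod m \<in> P \<longleftrightarrow> x mod m \<in> Q" by blast
      then show ?thesis by (simp add: cut_sets_mod[OF P] cut_sets_mod[OF Q])
    qed
    then show "P = Q" by blast
  qed
qed auto

lemma cut_count_translate: "cut_count (translate k P) x = cut_count P (x + k) - cut_count P k"
proof -
  have "cut_count P (x + k) = cut_count P (0 + k) + cut_count (translate k P) x"
  proof (rule cut_count_unique)
    show "cut_count P (x + 1 + k) = cut_count P (x + k) + (if x + 1 \<in> translate k P then 1 else 0)" for x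
      using cut_count_add1[of P "x + k"] by (simp add: translate_def algebra_simps)
  qed
  then show ?thesis by simp
qed

lemma cut_count_negate: "cut_count (negate P) x = cut_count P (- 1) - cut_count P (- x - 1)"
proof -
  have "- cut_count P (- x - 1) = - cut_count P (- 0 - 1) + cut_count (negate P) x"
  proof (rule cut_count_unique[where f = "\<lambda>x. - cut_count P (- x - 1)"])
    show "- cut_count P (- (x + 1) - 1) = - cut_count P (- x - 1) + (if x + 1 \<in> negate P then 1 else 0)" for x
    proof -
      have eqs: "- x - 2 + 1 = - x - 1" "- (x + 1) - 1 = - x - 2" by simp_all
      have "x + 1 \<in> negate P \<longleftrightarrow> - x - 1 \<in> P" by (simp add: negate_def)
      with cut_count_add1[of P "- x - 2"] show ?thesis unfolding eqs by simp
    qed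
  qed
  then show ?thesis by simp
qed

lemma cut_count_add_period: "P \<in> cut_sets m \<Longrightarrow> cut_count P (x + m) = cut_count P x + cut_count P m"
  using cut_count_translate[of m P x] by (simp add: translate_period)

section \<open>Symmetries of cut sets acting on boards\<close>

text \<open>Moving the origin changes both counts in \<open>cell_time\<close> by the same constant,
  so a translation is merely a shift of time.\<close>

lemma cell_translate: "cell (translate k P) t s \<longleftrightarrow> cell P (t + 4 * cut_count P k - k) s"
proof
  assume "cell (translate k P) t s"
  then obtain a where "a \<in> translate k P" "a + s \<in> translate k P" "cell_time (translate k P) a (a + s) = t"
    by (auto simp: cell_def)
  then show "cell P (t + 4 * cut_count P k - k) s"
    unfolding cell_def cell_time_def cut_count_translate
    by (intro exI[of _ "a + k"]) (auto simp: translate_def algebra_simps)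
next
  assume "cell P (t + 4 * cut_count P k - k) s"
  then obtain a where "a \<in> P" "a + s \<in> P" "cell_time P a (a + s) = t + 4 * cut_count P k - k"
    by (auto simp: cell_def)
  then show "cell (translate k P) t s"
    unfolding cell_def cell_time_def cut_count_translate
    by (intro exI[of _ "a - k"]) (auto simp: translate_def algebra_simps)
qed

lemma row_translate: "row m (translate k P) t = row m P (t + 4 * cut_count P k - k)"
  by (simp add: row_def cell_translate)

text \<open>The snake from \<open>a\<close> to \<open>a + m\<close>, read backwards, is the snake of
  the negated set starting at \<open>- (a + m)\<close>.\<close>

lemma cell_negate:
  assumes P: "P \<in> cut_sets m"
  shows "cell (negate P) t (m - s) \<longleftrightarrow> cell P (4 * cut_count P (- 1) + 4 - 2 * cut_count P m - t) s"
proof -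
  \<comment> \<open>The extra 1 arises because negation turns intervals open on the left into
    intervals open on the right. \<open>cell_time\<close> doubles two such counts, hence the
    constant \<open>4 * cut_count P (- 1) + 4\<close>.\<close>
  have c: "cut_count (negate P) (- x) = cut_count P (- 1) - cut_count P x + 1" if "x \<in> P" for x
    using that cut_count_add1[of P "x - 1"] by (simp add: cut_count_negate)
  have p: "a + m \<in> P \<longleftrightarrow> a \<in> P" "cut_count P (a + m) = cut_count P a + cut_count P m" for a
    using cut_sets_periodic[OF P] cut_count_add_period[OF P] by auto
  have *: "cell_time (negate P) (- (a + m)) (- (a + s)) = 4 * cut_count P (- 1) + 4 - 2 * cut_count P m - cell_time P a (a + s)"
    if "a \<in> P" "a + s \<in> P" for a
    using that c[of "a + m"] c[of "a + s"] p[of a] by (simp add: cell_time_def)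
  show ?thesis
  proof
    assume "cell (negate P) t (m - s)"
    then obtain c where c: "- c \<in> P" "- (c + (m - s)) \<in> P" "cell_time (negate P) c (c + (m - s)) = t"
      by (auto simp: cell_def negate_def)
    define a where "a = - c - m"
    have "c = - (a + m)" "c + (m - s) = - (a + s)" by (auto simp: a_def)
    with c have a: "a + m \<in> P" "a + s \<in> P" "cell_time (negate P) (- (a + m)) (- (a + s)) = t"
      by (simp_all add: add.commute)
    with *[of a] p(1)[of a] show "cell P (4 * cut_count P (- 1) + 4 - 2 * cut_count P m - t) s"
      unfolding cell_def by (intro exI[of _ a]) simp
  next
    assume "cell P (4 * cut_count P (- 1) + 4 - 2 * cut_count P m - t) s"
    then obtain a where a: "a \<in> P" "a + s \<in> P" "cell_time P a (a + s) = 4 * cut_count P (- 1) + 4 - 2 * cut_count P m - t"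
      by (auto simp: cell_def)
    have "- (a + m) + (m - s) = - (a + s)" by simp
    with a *[of a] p[of a] show "cell (negate P) t (m - s)"
      unfolding cell_def by (intro exI[of _ "- (a + m)"]) (simp add: negate_def add.commute)
  qed
qed

lemma row_negate:
  assumes P: "P \<in> cut_sets (int m)"
  shows "row m (negate P) t =
    reverse_set (m + 1) (row m P (4 * cut_count P (- 1) + 4 - 2 * cut_count P (int m) - t))"
    (is "_ = reverse_set _ (row m P ?u)")
proof -
  have *: "m + 2 - i \<in> row m (negate P) t \<longleftrightarrow> i \<in> row m P ?u" if "i \<in> {1..m+1}" for i
  proof -
    have "int (m + 2 - i) - 1 = int m - (int i - 1)" using that by auto
    moreover have "m + 2 - i \<in> {1..m+1}" using that by auto
    ultimately show ?thesis
      unfolding row_def using cell_negate[OF P, of t "int i - 1"] that by (simp only: mem_Collect_eq)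
  qed
  have sub: "row m Q v \<subseteq> {1..m+1}" for Q v by (auto simp: row_def)
  show ?thesis
  proof (rule set_eqI)
    fix j
    show "j \<in> row m (negate P) t \<longleftrightarrow> j \<in> reverse_set (m + 1) (row m P ?u)"
    proof
      assume j: "j \<in> row m (negate P) t"
      with sub have "j \<in> {1..m+1}" by blast
      then have "m + 2 - j \<in> {1..m+1}" "m + 2 - (m + 2 - j) = j" by auto
      with *[of "m + 2 - j"] j have "m + 2 - j \<in> row m P ?u" by simp
      then show "j \<in> reverse_set (m + 1) (row m P ?u)"
        unfolding reverse_set_def by (rule rev_image_eqI) (use \<open>j \<in> {1..m+1}\<close> in auto)
    next
      assume "j \<in> reverse_set (m + 1) (row m P ?u)"
      then obtain i where "i \<in> row m P ?u" "j = m + 2 - i" by (auto simp: reverse_set_def)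
      with * sub show "j \<in> row m (negate P) t" by blast
    qed
  qed
qed

section \<open>Boards as complete toggle orbits\<close>

text \<open>\<open>orbit\<close> collects forward iterates only. Rows at earlier times are reached
  as well, because every row lies in its own orbit and membership can then be swapped.\<close>

lemma board_orbit_eq_orbit:
  assumes P: "P \<in> cut_sets (int m)" "0 < m"
  shows "board_orbit m P = orbit (phi (m + 1)) (row m P t)"
proof -
  have self: "row m P u \<in> orbit (phi (m + 1)) (row m P u)" for u
    by (rule phi_orbit_self[OF row_indep[OF P(1)]])
  have fwd: "row m P v \<in> orbit (phi (m + 1)) (row m P u)" if "u \<le> v" for u v
    using funpow_in_orbit[OF self, of "nat (v - u)" u] that unfolding funpow_phi_row[OF P] by simp
  have "row m P v \<in> orbit (phi (m + 1)) (row m P t)" for v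
    using fwd[of t v] orbit_swap[OF self fwd[of v t]] by linarith
  moreover have "S \<in> board_orbit m P" if "S \<in> orbit (phi (m + 1)) (row m P t)" for S
    using that unfolding orbit_altdef board_orbit_def funpow_phi_row[OF P] by blast
  ultimately show ?thesis by (auto simp: board_orbit_def)
qed

lemma board_orbit_translate: "board_orbit m (translate k P) = board_orbit m P"
proof -
  have "row m P t = row m (translate k P) (t - (4 * cut_count P k - k))" for t
    by (simp add: row_translate)
  then have "board_orbit m P \<subseteq> board_orbit m (translate k P)"
    unfolding board_orbit_def by blast
  moreover have "board_orbit m (translate k P) \<subseteq> board_orbit m P"
    unfolding board_orbit_def row_translate by blast
  ultimately show ?thesis by blast
qed

text \<open>If \<open>s\<close> were skipped by \<open>Q\<close>, the first snake of \<open>Q\<close> would jump over the occupied cell.\<close>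

lemma row_inj_step:
  assumes P: "P \<in> cut_sets (int m)" "0 \<in> P" and Q: "Q \<in> cut_sets (int m)" "0 \<in> Q"
    and m: "0 < m" and eq: "row m P 0 = row m Q 0"
    and s: "0 < s" "s \<le> int m" and cut_count: "cut_count P (s - 1) = cut_count Q (s - 1)" and "s \<in> P"
  shows "s \<in> Q"
proof (rule ccontr)
  assume "s \<notin> Q"
  then have Q1: "s + 1 \<in> Q" using cut_sets_cover[OF Q(1), of s] by simp
  \<comment> \<open>The snake starting at 0 is in row \<open>v + 1\<close> at index \<open>s\<close>
    for \<open>P\<close>, and already in row \<open>v\<close> at index \<open>s + 1\<close> for
    \<open>Q\<close>.\<close>
  define v where "v = 2 * cut_count P (s - 1) + 1 - s"
  have c: "cut_count P s = cut_count P (s - 1) + 1" "cut_count Q (s + 1) = cut_count P (s - 1) + 1"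
    using cut_count_add1[of P "s - 1"] cut_count_add1[of Q "s - 1"] cut_count_add1[of Q s] \<open>s \<in> P\<close> \<open>s \<notin> Q\<close> Q1 cut_count
    by simp_all
  \<comment> \<open>Equality of rows propagates only forward from row 0, so the row under comparison
    must not be earlier.\<close>
  have "0 \<le> v + 1"
    using drift_mono[OF P \<open>s \<in> P\<close>] s c by (simp add: v_def)
  then have rows: "row m P (v + 1) = row m Q (v + 1)"
    using funpow_phi_row[OF P(1) m, of "nat (v + 1)" 0] funpow_phi_row[OF Q(1) m, of "nat (v + 1)" 0] eq
    by simp
  have "cell P (v + 1) s"
    unfolding cell_def using P(2) \<open>s \<in> P\<close> c by (intro exI[of _ 0]) (simp add: cell_time_def v_def)
  then have "nat (s + 1) \<in> row m P (v + 1)" using s by (auto simp: row_def)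
  then have "cell Q (v + 1) s" using s by (simp add: rows) (simp add: row_def)
  moreover have "cell Q v (s + 1)"
    unfolding cell_def using Q(2) Q1 c by (intro exI[of _ 0]) (simp add: cell_time_def v_def)
  ultimately show False using not_cell_below_left[OF Q(1)] by blast
qed

lemma row_inj:
  assumes P: "P \<in> cut_sets (int m)" "0 \<in> P" and Q: "Q \<in> cut_sets (int m)" "0 \<in> Q"
    and m: "0 < m" and eq: "row m P 0 = row m Q 0"
  shows "P = Q"
proof -
  have ind: "s \<le> int m \<longrightarrow> (s \<in> P \<longleftrightarrow> s \<in> Q) \<and> cut_count P s = cut_count Q s" if "0 \<le> s" for s
    using that
  proof (induction s rule: int_ge_induct)
    case base
    then show ?case using P Q by simp
  next
    case (step s)
    show ?case
    proof
      assume le: "s + 1 \<le> int m"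
      with step have c: "cut_count P (s + 1 - 1) = cut_count Q (s + 1 - 1)" by simp
      have "s + 1 \<in> P \<longleftrightarrow> s + 1 \<in> Q"
        using row_inj_step[OF P Q m eq _ le c] row_inj_step[OF Q P m eq[symmetric] _ le c[symmetric]]
          step.hyps by auto
      with c show "(s + 1 \<in> P \<longleftrightarrow> s + 1 \<in> Q) \<and> cut_count P (s + 1) = cut_count Q (s + 1)"
        using cut_count_add1[of P s] cut_count_add1[of Q s] by simp
    qed
  qed
  have "x \<in> P \<longleftrightarrow> x \<in> Q" for x
    using cut_sets_mod[OF P(1), of x] cut_sets_mod[OF Q(1), of x] ind[of "x mod int m"] m
    by (simp add: less_imp_le)
  then show ?thesis by blast
qed

lemma one_in_row_iff: "Suc 0 \<in> row m P t \<longleftrightarrow> (\<exists>a\<in>P. t = 4 * cut_count P a - a)"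
  by (auto simp: row_def cell_def cell_time_def)

lemma necklace_eq_iff: "necklace P = necklace Q \<longleftrightarrow> (\<exists>k. Q = translate k P)"
proof
  assume "necklace P = necklace Q"
  moreover have "translate 0 Q \<in> necklace Q" unfolding necklace_def by blast
  ultimately have "Q \<in> necklace P" by simp
  then show "\<exists>k. Q = translate k P" by (auto simp: necklace_def)
next
  assume "\<exists>k. Q = translate k P"
  then obtain k where Q: "Q = translate k P" by blast
  have "translate j P \<in> necklace Q" for j
    unfolding Q necklace_def translate_translate by (rule range_eqI[of _ _ "j - k"]) simp
  moreover have "translate j Q \<in> necklace P" for j
    unfolding Q necklace_def translate_translate by blast
  ultimately show "necklace P = necklace Q" by (auto simp: necklace_def)
qed

text \<open>A row in which some snake of \<open>P\<close> starts has column 1 occupied, so in the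
  board of \<open>Q\<close> it is also the start of a snake. Translating both starting points to 0
  puts both rows at time 0, where a row determines its cut set.\<close>

lemma board_orbit_eq_iff:
  assumes P: "P \<in> cut_sets (int m)" and Q: "Q \<in> cut_sets (int m)" and m: "0 < m"
  shows "board_orbit m P = board_orbit m Q \<longleftrightarrow> necklace P = necklace Q"
proof
  assume "necklace P = necklace Q"
  then show "board_orbit m P = board_orbit m Q"
    by (auto simp: necklace_eq_iff board_orbit_translate)
next
  assume eq: "board_orbit m P = board_orbit m Q"
  obtain a where a: "a \<in> P" using cut_sets_cover[OF P] by blast
  have "row m P (4 * cut_count P a - a) \<in> board_orbit m Q"
    unfolding eq[symmetric] by (simp add: board_orbit_def)
  then obtain t where t: "row m P (4 * cut_count P a - a) = row m Q t" by (auto simp: board_orbit_def)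
  have "Suc 0 \<in> row m P (4 * cut_count P a - a)" using a by (auto simp: one_in_row_iff)
  then obtain b where b: "b \<in> Q" "t = 4 * cut_count Q b - b" by (auto simp: t one_in_row_iff)
  have "translate a P = translate b Q"
  proof (rule row_inj[OF translate_cut_sets[OF P] _ translate_cut_sets[OF Q] _ m])
    show "0 \<in> translate a P" "0 \<in> translate b Q" using a b by (auto simp: translate_def)
    show "row m (translate a P) 0 = row m (translate b Q) 0" using t b by (simp add: row_translate)
  qed
  then have "Q = translate (a - b) P" using translate_eq_iff[of a P b Q] by simp
  then show "necklace P = necklace Q" unfolding necklace_eq_iff by blast
qed

lemma add1_mod_int:
  fixes x m :: int
  assumes "0 < m"
  shows "(x + 1) mod m = (if x mod m = m - 1 then 0 else x mod m + 1)"
proof (cases "x mod m = m - 1")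
  case True
  then show ?thesis using mod_add_left_eq[of x m 1] by simp
next
  case False
  then have "x mod m + 1 < m" using pos_mod_bound[OF assms, of x] by linarith
  then have "(x mod m + 1) mod m = x mod m + 1" using assms by (intro mod_pos_pos_trivial) auto
  with False show ?thesis by (simp add: mod_add_left_eq)
qed

text \<open>
  Every cut set through 0 is determined by its row 0, and conversely an independent set containing 1
  can be encoded as a cut set through 0, so the two finite families are equinumerous and the first
  injection is onto.
\<close>

lemma ex_row_eq:
  assumes m: "0 < m" and S: "S \<in> indep_sets (m + 1)" "Suc 0 \<in> S"
  shows "\<exists>P\<in>cut_sets (int m). row m P 0 = S"
proof -
  define X where "X = {S \<in> indep_sets (m + 1). Suc 0 \<in> S}"
  define Y where "Y = {P \<in> cut_sets (int m). 0 \<in> P}"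
  \<comment> \<open>Residue \<open>j\<close> stands for column \<open>j + 2\<close>, and cut points
    are the empty columns. As column 1 is occupied, column 2 is empty, so 0 is a cut point and the
    wrap from residue \<open>m - 1\<close> to 0 causes no violation. The map serves only to bound
    the cardinality and need not invert the row map.\<close>
  define f where "f = (\<lambda>S. {x. nat (x mod int m + 2) \<notin> S})"
  have fin: "finite X" "finite Y"
    using finite_indep_sets[of "m + 1"] finite_cut_sets[of "int m"] m by (auto simp: X_def Y_def)
  have "f S \<in> Y" if "S \<in> X" for S
  proof -
    have no2: "Suc (Suc 0) \<notin> S" and nc: "\<not> (i \<in> S \<and> Suc i \<in> S)" for i
      using that by (auto simp: X_def indep_sets_def)
    have "x \<in> f S \<or> x + 1 \<in> f S" for x
    proof (cases "x mod int m = int m - 1")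
      case True
      then have "(x + 1) mod int m = 0" using m by (simp add: add1_mod_int)
      then show ?thesis using no2 by (simp add: f_def numeral_2_eq_2)
    next
      case False
      then have "(x + 1) mod int m = x mod int m + 1" using m by (simp add: add1_mod_int)
      moreover have "nat (x mod int m + 1 + 2) = Suc (nat (x mod int m + 2))"
        using m pos_mod_sign[of "int m" x] by linarith
      ultimately show ?thesis using nc[of "nat (x mod int m + 2)"] by (auto simp: f_def)
    qed
    moreover have "0 \<in> f S" using no2 by (simp add: f_def numeral_2_eq_2)
    ultimately show ?thesis by (simp add: Y_def cut_sets_def) (simp add: f_def)
  qed
  moreover have "inj_on f X"
  proof (rule inj_onI)
    fix S T assume S: "S \<in> X" and T: "T \<in> X" and eq: "f S = f T"
    show "S = T"
    proof (rule set_eqI)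
      fix i
      consider "i = 1" | "i = 2" | "i < 1 \<or> i > m + 1" | "3 \<le> i" "i \<le> m + 1" by linarith
      then show "i \<in> S \<longleftrightarrow> i \<in> T"
      proof cases
        case 4
        have "j \<in> f U \<longleftrightarrow> nat (j + 2) \<notin> U" if "j = int i - 2" for U j
          using 4 that by (simp add: f_def)
        from this[OF refl] eq show ?thesis using 4 by (auto simp: set_eq_iff)
      qed (use S T in \<open>auto simp: X_def indep_sets_def numeral_2_eq_2\<close>)
    qed
  qed
  ultimately have "card X \<le> card Y" using fin by (intro card_inj_on_le[of f]) auto
  moreover have "inj_on (\<lambda>P. row m P 0) Y"
    using row_inj m by (intro inj_onI) (auto simp: Y_def)
  moreover have "(\<lambda>P. row m P 0) ` Y \<subseteq> X"
    using row_indep by (force simp: X_def Y_def one_in_row_iff)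
  ultimately have "(\<lambda>P. row m P 0) ` Y = X"
    using fin by (metis card_image card_seteq)
  moreover have "S \<in> X" using S by (simp add: X_def)
  ultimately show ?thesis unfolding Y_def by blast
qed

section \<open>Reaching a row with column 1 occupied\<close>

lemma fold_toggle_other: "i \<notin> set xs \<Longrightarrow> i \<in> fold (toggle n) xs S \<longleftrightarrow> i \<in> S"
proof (induction xs arbitrary: S)
  case (Cons j xs)
  then have "i \<in> toggle n j S \<longleftrightarrow> i \<in> S" by (auto simp: toggle_def)
  with Cons show ?case by simp
qed simp

lemma one_in_phi:
  assumes "S \<in> indep_sets n" "0 < n" "Suc 0 \<notin> S" "Suc (Suc 0) \<notin> S"
  shows "Suc 0 \<in> phi n S"
proof -
  have upt: "[1..<Suc n] = Suc 0 # [2..<Suc n]"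
    using assms(2) upt_conv_Cons[of 1 "Suc n"] by (simp add: numeral_2_eq_2 del: upt_Suc)
  have "insert (Suc 0) S \<in> indep_sets n" using assms by (auto simp: indep_sets_def)
  then have "Suc 0 \<in> toggle n (Suc 0) S" using assms(3) by (simp add: toggle_def)
  then show ?thesis unfolding phi_def upt by (simp add: fold_toggle_other)
qed

lemma two_notin_phi:
  assumes "S \<in> indep_sets n" "1 < n" "Suc (Suc 0) \<in> S"
  shows "Suc (Suc 0) \<notin> phi n S"
proof -
  have upt: "[1..<Suc n] = Suc 0 # Suc (Suc 0) # [3..<Suc n]"
    
    using assms(2) upt_conv_Cons[of 1 "Suc n"] upt_conv_Cons[of 2 "Suc n"]
    by (simp add: numeral_2_eq_2 numeral_3_eq_3 del: upt_Suc)
  have "Suc (Suc 0) \<in> toggle n (Suc 0) S" using assms(3) by (auto simp: toggle_def)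
  then have "Suc (Suc 0) \<notin> toggle n (Suc (Suc 0)) (toggle n (Suc 0) S)"
    by (simp add: toggle_def[of n "Suc (Suc 0)"])
  then show ?thesis unfolding phi_def upt by (simp add: fold_toggle_other)
qed

text \<open>At most two sweeps occupy column 1: if it stays empty in the first, column 2 was
  blocking it, and that sweep clears column 2.\<close>

lemma ex_board_orbit_eq:
  assumes m: "0 < m" and S: "S \<in> indep_sets (m + 1)"
  shows "\<exists>P\<in>cut_sets (int m). orbit (phi (m + 1)) S = board_orbit m P"
proof -
  have closed: "phi (m + 1) T \<in> indep_sets (m + 1)" if "T \<in> indep_sets (m + 1)" for T
    using bij_betw_phi[of "m + 1"] that by (rule bij_betwE[THEN bspec])
  have step: "orbit (phi (m + 1)) (phi (m + 1) T) = orbit (phi (m + 1)) T"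
    if "T \<in> indep_sets (m + 1)" for T
    using phi_orbit_self[OF that] by (rule self_in_orbit_step)
  have "\<exists>T\<in>indep_sets (m + 1). Suc 0 \<in> T \<and> orbit (phi (m + 1)) T = orbit (phi (m + 1)) S"
  proof (cases "Suc 0 \<in> S \<or> Suc 0 \<in> phi (m + 1) S")
    case True
    then show ?thesis using S closed step by blast
  next
    case False
    then have "Suc (Suc 0) \<in> S" using one_in_phi[OF S] by auto
    then have "Suc (Suc 0) \<notin> phi (m + 1) S" using two_notin_phi[OF S] m by simp
    then have "Suc 0 \<in> phi (m + 1) (phi (m + 1) S)"
      using one_in_phi[OF closed[OF S]] False by simp
    then show ?thesis using closed step S by metis
  qed
  then obtain T where T: "T \<in> indep_sets (m + 1)" "Suc 0 \<in> T"
    "orbit (phi (m + 1)) T = orbit (phi (m + 1)) S" by blast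
  obtain P where "P \<in> cut_sets (int m)" "row m P 0 = T" using ex_row_eq[OF m T(1,2)] by blast
  with T(3) board_orbit_eq_orbit[OF _ m, of P 0] show ?thesis by auto
qed

lemma phi_orbits_eq:
  assumes m: "0 < m"
  shows "phi_orbits (m + 1) = board_orbit m ` cut_sets (int m)"
proof
  show "phi_orbits (m + 1) \<subseteq> board_orbit m ` cut_sets (int m)"
    using ex_board_orbit_eq[OF m] by (force simp: phi_orbits_def)
  show "board_orbit m ` cut_sets (int m) \<subseteq> phi_orbits (m + 1)"
    using board_orbit_eq_orbit[OF _ m, of _ 0] row_indep by (force simp: phi_orbits_def)
qed

lemma reversible_board_orbit_iff:
  assumes P: "P \<in> cut_sets (int m)" and m: "0 < m"
  shows "reversible (m + 1) (board_orbit m P) \<longleftrightarrow> negate P \<in> necklace P"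
proof -
  define c where "c = 4 * cut_count P (- 1) + 4 - 2 * cut_count P (int m)"
  have rev: "reverse_set (m + 1) (row m P t) = row m (negate P) (c - t)" for t
    unfolding row_negate[OF P] by (simp add: c_def)
  note N = negate_cut_sets[OF P]
  have "reversible (m + 1) (board_orbit m P) \<longleftrightarrow> board_orbit m (negate P) = board_orbit m P"
  proof
    assume "reversible (m + 1) (board_orbit m P)"
    then obtain t u where "reverse_set (m + 1) (row m P t) = row m P u"
      by (auto simp: reversible_def board_orbit_def)
    then have "row m (negate P) (c - t) = row m P u" by (simp only: rev)
    then show "board_orbit m (negate P) = board_orbit m P"
      by (metis board_orbit_eq_orbit[OF P m] board_orbit_eq_orbit[OF N m])
  next
    assume eq: "board_orbit m (negate P) = board_orbit m P"
    have "reverse_set (m + 1) (row m P 0) \<in> board_orbit m P"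
      unfolding rev eq[symmetric] by (simp add: board_orbit_def)
    then show "reversible (m + 1) (board_orbit m P)"
      unfolding reversible_def by (auto simp: board_orbit_def)
  qed
  also have "\<dots> \<longleftrightarrow> necklace P = necklace (negate P)"
    using board_orbit_eq_iff[OF N P m] by auto
  also have "\<dots> \<longleftrightarrow> negate P \<in> necklace P"
    unfolding necklace_eq_iff by (auto simp: necklace_def)
  finally show ?thesis .
qed

subsection \<open>Orbit counting\<close>

lemma translate_mod:
  assumes P: "P \<in> cut_sets m"
  shows "translate (k mod m) P = translate k P"
proof -
  have "x + k mod m \<in> P \<longleftrightarrow> x + k \<in> P" for x
    using cut_sets_periodic_mult[OF P, of "x + k mod m" "k div m"]
    by (simp add: add.assoc mod_mult_div_eq)
  then show ?thesis by (simp add: translate_def)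
qed

lemma necklace_eq_image:
  assumes P: "P \<in> cut_sets m" and "0 < m"
  shows "necklace P = (\<lambda>k. translate k P) ` {0..<m}"
proof -
  have "translate k P \<in> (\<lambda>k. translate k P) ` {0..<m}" for k
    by (rule image_eqI[of _ _ "k mod m"]) (use assms translate_mod[OF P] in auto)
  then show ?thesis by (auto simp: necklace_def)
qed

text \<open>Orbit-stabilizer: the shifts modulo \<open>m\<close> taking \<open>P\<close> to a fixed
  translate form a coset of the stabilizer.\<close>

lemma card_translations_mult:
  assumes P: "P \<in> cut_sets m" and "0 < m" and Q: "Q \<in> necklace P"
  shows "card {k \<in> {0..<m}. translate k P = Q} * card (necklace P) = nat m"
proof -
  define stab where "stab = {k \<in> {0..<m}. translate k P = P}"
  have *: "card {k \<in> {0..<m}. translate k P = R} = card stab" if "R \<in> necklace P" for R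
  proof -
    obtain j where R: "R = translate j P" using \<open>R \<in> necklace P\<close> by (auto simp: necklace_def)
    have "bij_betw (\<lambda>k. (k + j) mod m) stab {k \<in> {0..<m}. translate k P = R}"
    proof (rule bij_betw_byWitness[of _ "\<lambda>k. (k - j) mod m"])
      show "\<forall>k\<in>stab. ((k + j) mod m - j) mod m = k"
        by (auto simp: stab_def mod_simps)
      show "\<forall>k\<in>{k \<in> {0..<m}. translate k P = R}. ((k - j) mod m + j) mod m = k"
        by (auto simp: mod_simps)
      show "(\<lambda>k. (k + j) mod m) ` stab \<subseteq> {k \<in> {0..<m}. translate k P = R}"
      proof (intro image_subsetI)
        fix k assume "k \<in> stab"
        then have "translate (k + j) P = translate j P"
          using translate_translate[of j k P] by (simp add: stab_def add.commute)
        then show "(k + j) mod m \<in> {k \<in> {0..<m}. translate k P = R}"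
          using \<open>0 < m\<close> by (simp add: R translate_mod[OF P])
      qed
      show "(\<lambda>k. (k - j) mod m) ` {k \<in> {0..<m}. translate k P = R} \<subseteq> stab"
      proof (intro image_subsetI)
        fix k assume "k \<in> {k \<in> {0..<m}. translate k P = R}"
        then have "translate (k - j) P = P" by (simp add: R translate_eq_iff)
        then show "(k - j) mod m \<in> stab"
          using \<open>0 < m\<close> by (simp add: stab_def translate_mod[OF P])
      qed
    qed
    then show ?thesis by (simp add: bij_betw_same_card)
  qed
  have "nat m = (\<Sum>k\<in>{0..<m}. 1)" by simp
  also have "\<dots> = (\<Sum>R\<in>necklace P. \<Sum>k\<in>{k \<in> {0..<m}. translate k P = R}. 1)"
    unfolding necklace_eq_image[OF P \<open>0 < m\<close>] by (rule sum.image_gen) simp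
  also have "\<dots> = (\<Sum>R\<in>necklace P. card stab)" using * by simp
  finally show ?thesis using *[OF Q] by (simp add: mult.commute)
qed

lemma sum_card_swap:
  assumes "finite A" "finite B"
  shows "(\<Sum>a\<in>A. card {b \<in> B. R a b}) = (\<Sum>b\<in>B. card {a \<in> A. R a b})"
proof -
  have "(\<Sum>a\<in>A. card {b \<in> B. R a b}) = (\<Sum>a\<in>A. \<Sum>b\<in>B. if R a b then 1 else 0)"
    using assms by (simp add: sum.inter_filter[symmetric] del: sum.inter_filter)
  also have "\<dots> = (\<Sum>b\<in>B. \<Sum>a\<in>A. if R a b then 1 else 0)" by (rule sum.swap)
  also have "\<dots> = (\<Sum>b\<in>B. card {a \<in> A. R a b})"
    using assms by (simp add: sum.inter_filter[symmetric] del: sum.inter_filter)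
  finally show ?thesis .
qed

lemma self_in_necklace: "P \<in> necklace P"
  using translate_0 unfolding necklace_def by (metis rangeI)

lemma necklace_eqI: "Q \<in> necklace P \<Longrightarrow> necklace Q = necklace P"
  using necklace_eq_iff[of P Q] by (auto simp: necklace_def)

text \<open>With \<open>r\<close> the identity this is Burnside's lemma for rotations; with
  \<open>r = negate\<close> it counts classes closed under negation. A class of size c contributes c
  members with m / c admissible shifts each, so m pairs in all.\<close>

lemma burnside_necklaces:
  assumes m: "0 < m"
    and inv: "\<And>P Q. P \<in> cut_sets m \<Longrightarrow> Q \<in> necklace P \<Longrightarrow> r P \<in> necklace P \<Longrightarrow> r Q \<in> necklace Q"
  shows "nat m * card (necklace ` {P \<in> cut_sets m. r P \<in> necklace P}) =
    (\<Sum>k\<in>{0..<m}. card {P \<in> cut_sets m. translate k P = r P})"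
proof -
  define G where "G = {P \<in> cut_sets m. r P \<in> necklace P}"
  define c where "c P = card {k \<in> {0..<m}. translate k P = r P}" for P
  have fin: "finite (cut_sets m)" using m by (rule finite_cut_sets)
  then have finG: "finite G" by (simp add: G_def)
  have class_sum: "sum c {Q \<in> G. necklace Q = N} = nat m" if N: "N \<in> necklace ` G" for N
  proof -
    obtain P where P: "P \<in> cut_sets m" "r P \<in> necklace P" and NP: "N = necklace P"
      using N by (auto simp: G_def)
    have mem: "Q \<in> G \<and> necklace Q = N \<longleftrightarrow> Q \<in> N" for Q
    proof
      assume "Q \<in> G \<and> necklace Q = N"
      then show "Q \<in> N" using self_in_necklace by blast
    next
      assume "Q \<in> N"
      then have Q: "Q \<in> necklace P" by (simp add: NP)
      then have "Q \<in> cut_sets m" using translate_cut_sets[OF P(1)] by (auto simp: necklace_def)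
      then show "Q \<in> G \<and> necklace Q = N"
        using inv[OF P(1) Q P(2)] necklace_eqI[OF Q] by (simp add: G_def NP)
    qed
    have cls: "{Q \<in> G. necklace Q = N} = N" unfolding mem by simp
    have "N \<subseteq> G" using mem by blast
    then have finN: "finite N" using finG by (rule finite_subset)
    have "P \<in> N" by (simp add: NP self_in_necklace)
    with finN have card_pos: "0 < card N" by (auto simp: card_gt_0_iff)
    have "c Q = nat m div card N" if "Q \<in> N" for Q
    proof -
      have "Q \<in> G" "necklace Q = N" using mem that by blast+
      then have "c Q * card N = nat m"
        using card_translations_mult[OF _ m, of Q "r Q"] by (simp add: c_def G_def)
      then have "nat m div card N = c Q * card N div card N" by simp
      with card_pos show ?thesis by simp
    qed
    then have "sum c N = card N * (nat m div card N)" by simp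
    moreover have "card N dvd nat m"
      using card_translations_mult[OF P(1) m P(2)] unfolding NP by (rule dvdI[OF sym, OF trans[OF mult.commute]])
    ultimately show ?thesis unfolding cls by simp
  qed
  have "(\<Sum>k\<in>{0..<m}. card {P \<in> cut_sets m. translate k P = r P}) = sum c (cut_sets m)"
    unfolding c_def using fin by (intro sum_card_swap) auto
  also have "\<dots> = sum c G"
  proof (rule sum.mono_neutral_right[OF fin])
    show "\<forall>P\<in>cut_sets m - G. c P = 0"
    proof
      fix P assume "P \<in> cut_sets m - G"
      then have "{k \<in> {0..<m}. translate k P = r P} = {}" by (auto simp: G_def necklace_def)
      then show "c P = 0" unfolding c_def by (simp only: card.empty)
    qed
  qed (auto simp: G_def)
  also have "\<dots> = (\<Sum>N\<in>necklace ` G. sum c {P \<in> G. necklace P = N})"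
    by (rule sum.image_gen[OF finG])
  also have "\<dots> = nat m * card (necklace ` G)" using class_sum by simp
  finally show ?thesis by (simp add: G_def)
qed

section \<open>Fixed points of a rotation and divisor sums\<close>

text \<open>Being fixed by a shift is just another period, and by Bezout two periods generate their
  gcd.\<close>

lemma fixed_cut_sets: "{P \<in> cut_sets m. translate k P = P} = cut_sets (gcd k m)"
proof (intro equalityI subsetI)
  fix P assume "P \<in> {P \<in> cut_sets m. translate k P = P}"
  then have P: "P \<in> cut_sets m" and fx: "translate k P = P" by auto
  have Pk: "P \<in> cut_sets k"
    using cut_sets_cover[OF P] fx by (auto simp: cut_sets_def translate_def set_eq_iff)
  obtain u v where uv: "u * k + v * m = gcd k m" using bezout_int by blast
  have "x + gcd k m \<in> P \<longleftrightarrow> x \<in> P" for x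
    using cut_sets_periodic_mult[OF P, of "x + u * k" v] cut_sets_periodic_mult[OF Pk, of x u]
    by (simp add: uv[symmetric] add.assoc)
  with cut_sets_cover[OF P] show "P \<in> cut_sets (gcd k m)" by (simp add: cut_sets_def)
next
  fix P assume P: "P \<in> cut_sets (gcd k m)"
  have per: "x + l \<in> P \<longleftrightarrow> x \<in> P" if "gcd k m dvd l" for l x
    using cut_sets_periodic_mult[OF P, of x] that by (auto elim!: dvdE simp: mult.commute)
  then show "P \<in> {P \<in> cut_sets m. translate k P = P}"
    using cut_sets_cover[OF P] by (simp add: cut_sets_def translate_def)
qed

lemma sum_gcd_eq_sum_divisors:
  fixes g :: "nat \<Rightarrow> nat"
  assumes m: "0 < m"
  shows "(\<Sum>k<m. g (gcd k m)) = (\<Sum>d | d dvd m. totient (m div d) * g d)"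
proof -
  \<comment> \<open>The index 0 is traded for \<open>m\<close>, which has the same gcd with
    \<open>m\<close>, to reach the index range of the totient count.\<close>
  have "(\<Sum>k<m. g (gcd k m)) + g (gcd m m) = (\<Sum>k\<le>m. g (gcd k m))"
    by (simp add: lessThan_Suc_atMost[symmetric])
  also have "{..m} = insert 0 {0<..m}" by auto
  also have "(\<Sum>k\<in>insert 0 {0<..m}. g (gcd k m)) = g (gcd m m) + (\<Sum>k\<in>{0<..m}. g (gcd k m))"
    by simp
  finally have "(\<Sum>k<m. g (gcd k m)) = (\<Sum>k\<in>{0<..m}. g (gcd k m))" by simp
  also have "\<dots> = (\<Sum>d | d dvd m. \<Sum>k\<in>{k\<in>{0<..m}. gcd k m = d}. g (gcd k m))"
    using m by (intro sum.group[symmetric]) auto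
  also have "\<dots> = (\<Sum>d | d dvd m. \<Sum>k\<in>{k\<in>{0<..m}. gcd k m = d}. g d)" by (intro sum.cong) auto
  also have "\<dots> = (\<Sum>d | d dvd m. totient (m div d) * g d)"
  proof (intro sum.cong refl)
    fix d assume "d \<in> {d. d dvd m}"
    then have "card {k \<in> {0<..m}. gcd k m = d} = totient (m div d)"
      using m by (simp only: card_gcd_eq_totient mem_Collect_eq)
    then show "(\<Sum>k\<in>{k \<in> {0<..m}. gcd k m = d}. g d) = totient (m div d) * g d"
      by (simp only: sum_constant of_nat_id)
  qed
  finally show ?thesis .
qed

section \<open>Fibonacci and Lucas counts\<close>

text \<open>These are complements of cut sets once the cycle, or the cycle folded by a reflection,
  has been opened to a path.\<close>

definition sparse_subsets :: "int \<Rightarrow> int \<Rightarrow> int set set" where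
  "sparse_subsets a b = {A. A \<subseteq> {a..<b} \<and> (\<forall>x. \<not> (x \<in> A \<and> x + 1 \<in> A))}"

lemma finite_sparse_subsets: "finite (sparse_subsets a b)"
  by (rule finite_subset[of _ "Pow {a..<b}"]) (auto simp: sparse_subsets_def)

lemma card_sparse_subsets_add: "card (sparse_subsets a (a + int n)) = fib (n + 2)"
proof (induction n rule: fib.induct)
  case 1
  have "sparse_subsets a (a + int 0) = {{}}" by (auto simp: sparse_subsets_def)
  then show ?case by (simp add: numeral_2_eq_2)
next
  case 2
  have "{a..<a + 1} = {a}" by auto
  then have "sparse_subsets a (a + int (Suc 0)) = {{}, {a}}"
    by (auto simp: sparse_subsets_def)
  then show ?case by (simp add: numeral_3_eq_3 numeral_2_eq_2)
next
  case (3 n)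
  define e where "e = a + int n + 1"
  have eqs: "a + int (Suc n) = e" "a + int (Suc (Suc n)) = e + 1" "a + int n = e - 1"
    by (auto simp: e_def)
  have "a \<le> e" by (simp add: e_def)
  have "sparse_subsets a (e + 1) = sparse_subsets a e \<union> insert e ` sparse_subsets a (e - 1)" (is "?L = ?R")
  proof (intro equalityI subsetI)
    fix A assume A: "A \<in> ?L"
    show "A \<in> ?R"
    proof (cases "e \<in> A")
      case True
      have "e - 1 \<notin> A"
      proof
        assume "e - 1 \<in> A"
        moreover have "e - 1 + 1 \<in> A" using True by simp
        ultimately show False using A unfolding sparse_subsets_def by blast
      qed
      have "x \<in> {a..<e - 1}" if "x \<in> A - {e}" for x
      proof -
        have "x \<in> {a..<e + 1}" "x \<noteq> e" "x \<noteq> e - 1"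
          using that A \<open>e - 1 \<notin> A\<close> by (auto simp: sparse_subsets_def)
        then show ?thesis by auto
      qed
      then have "A - {e} \<subseteq> {a..<e - 1}" by (rule subsetI)
      with A have "A - {e} \<in> sparse_subsets a (e - 1)" unfolding sparse_subsets_def by blast
      moreover have "A = insert e (A - {e})" using True by auto
      ultimately show ?thesis by blast
    next
      case False
      have "x \<in> {a..<e}" if "x \<in> A" for x
      proof -
        have "x \<in> {a..<e + 1}" "x \<noteq> e" using that A False by (auto simp: sparse_subsets_def)
        then show ?thesis by auto
      qed
      then show ?thesis using A by (auto simp: sparse_subsets_def)
    qed
  next
    fix A assume "A \<in> ?R"
    then show "A \<in> ?L" using \<open>a \<le> e\<close> by (fastforce simp: sparse_subsets_def)
  qed
  moreover have "sparse_subsets a e \<inter> insert e ` sparse_subsets a (e - 1) = {}"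
    by (auto simp: sparse_subsets_def)
  moreover have "inj_on (insert e) (sparse_subsets a (e - 1))"
  proof (rule inj_onI)
    fix A B assume "A \<in> sparse_subsets a (e - 1)" "B \<in> sparse_subsets a (e - 1)" "insert e A = insert e B"
    moreover from this have "e \<notin> A" "e \<notin> B" by (auto simp: sparse_subsets_def)
    ultimately show "A = B" by (simp add: insert_ident)
  qed
  ultimately have "card (sparse_subsets a (e + 1)) = card (sparse_subsets a e) + card (sparse_subsets a (e - 1))"
    by (simp add: card_Un_disjoint finite_sparse_subsets card_image)
  with 3[unfolded eqs] show ?case unfolding eqs by simp
qed

lemma card_sparse_subsets: "card (sparse_subsets a b) = fib (nat (b - a) + 2)"
proof (cases "a \<le> b")
  case True
  then show ?thesis using card_sparse_subsets_add[of a "nat (b - a)"] by simp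
next
  case False
  then have "sparse_subsets a b = {{}}" by (auto simp: sparse_subsets_def)
  with False show ?thesis by (simp add: numeral_2_eq_2)
qed

text \<open>Passing to complements gives independent sets of the quotient of the integer line by
  \<open>r\<close>. When \<open>r x = r (x + 1)\<close>, that point carries a loop and cannot belong
  to \<open>A\<close>.\<close>

lemma card_folded_cut_sets:
  fixes r :: "int \<Rightarrow> int"
  assumes r: "\<And>x. r (r x) = r x"
  shows "card {P. (\<forall>x. x \<in> P \<longleftrightarrow> r x \<in> P) \<and> (\<forall>x. x \<in> P \<or> x + 1 \<in> P)} =
    card {A. A \<subseteq> range r \<and> (\<forall>x. \<not> (r x \<in> A \<and> r (x + 1) \<in> A))}" (is "card ?L = card ?R")
proof (rule bij_betw_same_card)
  show "bij_betw (\<lambda>P. range r - P) ?L ?R"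
  proof (rule bij_betw_byWitness[of _ "\<lambda>A. {x. r x \<notin> A}"])
    show "\<forall>P\<in>?L. {x. r x \<notin> range r - P} = P" by auto
    show "\<forall>A\<in>?R. range r - {x. r x \<notin> A} = A" using r by force
    show "(\<lambda>P. range r - P) ` ?L \<subseteq> ?R" by blast
    show "(\<lambda>A. {x. r x \<notin> A}) ` ?R \<subseteq> ?L" using r by auto
  qed
qed

text \<open>A Lucas number: independent sets of a cycle, split by whether they contain 0. If they
  do, both neighbours of 0 drop out.\<close>

lemma card_cut_sets:
  assumes "0 < d"
  shows "card (cut_sets (int d)) = fib (d - 1) + fib (d + 1)"
proof -
  define D where "D = int d"
  have D: "0 < D" using assms by (simp add: D_def)
  define T where "T = {A. A \<subseteq> {0..<D} \<and> (\<forall>x. \<not> (x mod D \<in> A \<and> (x + 1) mod D \<in> A))}"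
  have "cut_sets D = {P. (\<forall>x. x \<in> P \<longleftrightarrow> x mod D \<in> P) \<and> (\<forall>x. x \<in> P \<or> x + 1 \<in> P)}" (is "_ = ?R")
  proof (intro equalityI subsetI)
    fix P assume "P \<in> cut_sets D"
    then show "P \<in> ?R" using cut_sets_mod by (auto simp: cut_sets_def)
  next
    fix P assume P: "P \<in> ?R"
    have "x + D \<in> P \<longleftrightarrow> x \<in> P" for x
    proof -
      have "x + D \<in> P \<longleftrightarrow> (x + D) mod D \<in> P" "x \<in> P \<longleftrightarrow> x mod D \<in> P" using P by blast+
      then show ?thesis by simp
    qed
    with P show "P \<in> cut_sets D" by (simp add: cut_sets_def)
  qed
  moreover have "range (\<lambda>x. x mod D) = {0..<D}"
  proof -
    have "x \<in> range (\<lambda>x. x mod D)" if "x \<in> {0..<D}" for x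
      using that by (intro range_eqI[of _ _ x]) simp
    then show ?thesis using D by auto
  qed
  ultimately have 1: "card (cut_sets D) = card T"
    using card_folded_cut_sets[of "\<lambda>x. x mod D"] by (simp add: T_def)
  have T_iff: "A \<in> T \<longleftrightarrow> A \<in> sparse_subsets 0 D \<and> \<not> (D - 1 \<in> A \<and> 0 \<in> A)" for A
  proof
    assume A: "A \<in> T"
    have sparse: "\<not> (x \<in> A \<and> x + 1 \<in> A)" for x
    proof
      assume x: "x \<in> A \<and> x + 1 \<in> A"
      then have "x mod D = x" "(x + 1) mod D = x + 1" using A by (auto simp: T_def)
      moreover have "\<not> (x mod D \<in> A \<and> (x + 1) mod D \<in> A)" using A unfolding T_def by blast
      ultimately show False using x by simp
    qed
    have "(D - 1) mod D = D - 1" "(D - 1 + 1) mod D = 0" using D mod_pos_pos_trivial[of "D - 1" D] by simp_all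
    moreover have "\<not> ((D - 1) mod D \<in> A \<and> (D - 1 + 1) mod D \<in> A)" using A unfolding T_def by blast
    ultimately have "\<not> (D - 1 \<in> A \<and> 0 \<in> A)" by (simp only: simp_thms)
    moreover have "A \<subseteq> {0..<D}" using A unfolding T_def by blast
    moreover note sparse
    ultimately show "A \<in> sparse_subsets 0 D \<and> \<not> (D - 1 \<in> A \<and> 0 \<in> A)"
      unfolding sparse_subsets_def by blast
  next
    assume A: "A \<in> sparse_subsets 0 D \<and> \<not> (D - 1 \<in> A \<and> 0 \<in> A)"
    then have sub: "A \<subseteq> {0..<D}" and sparse: "\<not> (y \<in> A \<and> y + 1 \<in> A)" for y
      unfolding sparse_subsets_def by blast+
    have "\<not> (x mod D \<in> A \<and> (x + 1) mod D \<in> A)" for x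
    proof (cases "x mod D = D - 1")
      case True
      then have "(x + 1) mod D = 0" by (simp add: add1_mod_int[OF D])
      with True A show ?thesis by simp
    next
      case False
      then have "(x + 1) mod D = x mod D + 1" by (simp add: add1_mod_int[OF D])
      with sparse[of "x mod D"] show ?thesis by simp
    qed
    with sub show "A \<in> T" unfolding T_def by blast
  qed
  \<comment> \<open>For \<open>d = 1\<close> the point 0 is its own neighbour, so no set may contain
    it.\<close>
  have split: "T = sparse_subsets 1 D \<union> (if d = 1 then {} else insert 0 ` sparse_subsets 2 (D - 1))" (is "_ = ?S")
  proof (intro equalityI subsetI)
    fix A assume A: "A \<in> T"
    show "A \<in> ?S"
    proof (cases "0 \<in> A")
      case True
      have S: "A \<in> sparse_subsets 0 D" "\<not> (D - 1 \<in> A \<and> 0 \<in> A)" using A T_iff by blast+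
      then have "\<not> (0 \<in> A \<and> 0 + 1 \<in> A)" "A \<subseteq> {0..<D}" unfolding sparse_subsets_def by blast+
      with S True have no: "D - 1 \<notin> A" "1 \<notin> A" "A \<subseteq> {0..<D}" by simp_all
      then have "d \<noteq> 1" using True by (auto simp: D_def)
      have "x \<in> {2..<D - 1}" if "x \<in> A - {0}" for x
      proof -
        have "x \<noteq> 0" "x \<noteq> 1" "x \<noteq> D - 1" "x \<in> {0..<D}" using no that by auto
        then show ?thesis by auto
      qed
      then have "A - {0} \<subseteq> {2..<D - 1}" by (rule subsetI)
      moreover have "A \<in> sparse_subsets 0 D" using A T_iff by blast
      ultimately have "A - {0} \<in> sparse_subsets 2 (D - 1)" unfolding sparse_subsets_def by blast
      moreover have "A = insert 0 (A - {0})" using True by auto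
      ultimately have "A \<in> insert 0 ` sparse_subsets 2 (D - 1)" by (rule rev_image_eqI)
      then show ?thesis using \<open>d \<noteq> 1\<close> by simp
    next
      case False
      have "x \<in> {1..<D}" if "x \<in> A" for x
      proof -
        have "x \<noteq> 0" "x \<in> {0..<D}" using that False A by (auto simp: T_def)
        then show ?thesis by auto
      qed
      then have "A \<subseteq> {1..<D}" by (rule subsetI)
      moreover have "A \<in> sparse_subsets 0 D" using A T_iff by blast
      ultimately have "A \<in> sparse_subsets 1 D" unfolding sparse_subsets_def by blast
      then show ?thesis by simp
    qed
  next
    fix A assume "A \<in> ?S"
    then consider "A \<in> sparse_subsets 1 D" | B where "B \<in> sparse_subsets 2 (D - 1)" "A = insert 0 B" "d \<noteq> 1"
      by (auto split: if_splits)
    then show "A \<in> T"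
    proof cases
      case 1
      then have A: "A \<subseteq> {1..<D}" "\<forall>x. \<not> (x \<in> A \<and> x + 1 \<in> A)" unfolding sparse_subsets_def by blast+
      from A(1) have "A \<subseteq> {0..<D}" "0 \<notin> A" by auto
      with A(2) show ?thesis unfolding T_iff sparse_subsets_def by blast
    next
      case 2
      then have "2 \<le> D" using D by (auto simp: D_def)
      have B: "B \<subseteq> {2..<D - 1}" "\<And>x. \<not> (x \<in> B \<and> x + 1 \<in> B)"
        using 2(1) unfolding sparse_subsets_def by blast+
      then have "0 \<notin> B" "1 \<notin> B" "D - 1 \<notin> B" "- 1 \<notin> B" by auto
      then have "\<not> (x \<in> A \<and> x + 1 \<in> A)" for x
        using B(2)[of x] 2(2) by (auto simp: add_eq_0_iff2)
      moreover have "A \<subseteq> {0..<D}" using B(1) 2(2) \<open>2 \<le> D\<close> by auto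
      moreover have "D - 1 \<notin> A" using \<open>D - 1 \<notin> B\<close> \<open>2 \<le> D\<close> 2(2) by simp
      ultimately show ?thesis unfolding T_iff sparse_subsets_def by blast
    qed
  qed
  have "sparse_subsets 1 D \<inter> insert 0 ` sparse_subsets 2 (D - 1) = {}"
    by (auto simp: sparse_subsets_def)
  moreover have "inj_on (insert 0) (sparse_subsets 2 (D - 1))"
  proof (rule inj_onI)
    fix A B :: "int set"
    assume "A \<in> sparse_subsets 2 (D - 1)" "B \<in> sparse_subsets 2 (D - 1)" "insert 0 A = insert 0 B"
    moreover from this have "0 \<notin> A" "0 \<notin> B" by (auto simp: sparse_subsets_def)
    ultimately show "A = B" by (simp add: insert_ident)
  qed
  ultimately have "card T = fib (nat (D - 1) + 2) + (if d = 1 then 0 else fib (nat (D - 3) + 2))"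
    unfolding split by (simp add: card_Un_disjoint finite_sparse_subsets card_image card_sparse_subsets)
  also have "nat (D - 1) + 2 = d + 1" using assms by (simp add: D_def)
  also have "(if d = 1 then 0 else fib (nat (D - 3) + 2)) = fib (d - 1)"
  proof -
    \<comment> \<open>For \<open>d = 2\<close> the difference \<open>D - 3\<close> is negative and
      \<open>nat\<close> gives 0, which still yields the correct value 1.\<close>
    consider "d = 1" | "d = 2" | "3 \<le> d" using assms by linarith
    then show ?thesis
    proof cases
      case 3
      then have "nat (D - 3) + 2 = d - 1" by (simp add: D_def)
      with 3 show ?thesis by simp
    qed (simp_all add: D_def numeral_2_eq_2)
  qed
  finally show ?thesis using 1 by (simp add: D_def)
qed

subsection \<open>Cut sets with a reflection symmetry\<close>

definition reflective :: "int \<Rightarrow> int \<Rightarrow> int set set" where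
  "reflective m k = {P \<in> cut_sets m. translate k P = negate P}"

text \<open>Translation by \<open>j\<close> conjugates one reflection into the other, so for a fixed
  period only the parity of \<open>k\<close> can matter.\<close>

lemma card_reflective_shift: "card (reflective m (k + 2 * j)) = card (reflective m k)"
proof (rule bij_betw_same_card)
  have *: "translate j P \<in> reflective m (l - 2 * j)" if "P \<in> reflective m l" for P l j
    using that translate_cut_sets[of P m j] translate_translate[of "- j" l P]
    by (simp add: reflective_def negate_translate)
  show "bij_betw (translate j) (reflective m (k + 2 * j)) (reflective m k)"
  proof (rule bij_betw_byWitness[of _ "translate (- j)"])
    show "translate j ` reflective m (k + 2 * j) \<subseteq> reflective m k"
      using *[of _ "k + 2 * j" j] by auto
    show "translate (- j) ` reflective m k \<subseteq> reflective m (k + 2 * j)"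
      using *[of _ k "- j"] by auto
  qed simp_all
qed

lemma reflective_add_period: "reflective m (k + m) = reflective m k"
proof -
  have "translate (k + m) P = translate k P" if "P \<in> cut_sets m" for P
    using translate_translate[of k m P] translate_period[OF that] by simp
  then show ?thesis by (auto simp: reflective_def)
qed

lemma reflective_iff:
  "P \<in> reflective m k \<longleftrightarrow> P \<in> cut_sets m \<and> (\<forall>x. k - x \<in> P \<longleftrightarrow> x \<in> P)"
proof -
  have "translate k P = negate P \<longleftrightarrow> (\<forall>x. x + k \<in> P \<longleftrightarrow> - x \<in> P)"
    by (auto simp: translate_def negate_def)
  also have "\<dots> \<longleftrightarrow> (\<forall>x. k - x \<in> P \<longleftrightarrow> x \<in> P)"
  proof safe
    fix x assume *: "\<forall>x. x + k \<in> P \<longleftrightarrow> - x \<in> P"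
    show "k - x \<in> P \<Longrightarrow> x \<in> P" "x \<in> P \<Longrightarrow> k - x \<in> P" using *[rule_format, of "- x"] by simp_all
  next
    fix x assume *: "\<forall>x. k - x \<in> P \<longleftrightarrow> x \<in> P"
    show "x + k \<in> P \<Longrightarrow> - x \<in> P" "- x \<in> P \<Longrightarrow> x + k \<in> P"
      using *[rule_format, of "- x"] by (simp_all add: add.commute)
  qed
  finally show ?thesis by (simp add: reflective_def)
qed

text \<open>Here \<open>r\<close> chooses a representative of \<open>x\<close> under shifts by
  \<open>m\<close> and the reflection at \<open>k\<close>, which turns both symmetries into
  invariance under one folding map.\<close>

lemma reflective_eq_folded:
  assumes refl: "\<And>x. r x = x mod m \<or> r x = (k - x) mod m"
    and per: "\<And>x. r (x + m) = r x" and sym: "\<And>x. r (k - x) = r x"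
  shows "reflective m k = {P. (\<forall>x. x \<in> P \<longleftrightarrow> r x \<in> P) \<and> (\<forall>x. x \<in> P \<or> x + 1 \<in> P)}" (is "_ = ?R")
proof (intro equalityI subsetI)
  fix P assume "P \<in> reflective m k"
  then have P: "P \<in> cut_sets m" and k: "\<And>x. k - x \<in> P \<longleftrightarrow> x \<in> P" by (auto simp: reflective_iff)
  have "x \<in> P \<longleftrightarrow> r x \<in> P" for x
    using refl[of x] cut_sets_mod[OF P, of x] cut_sets_mod[OF P, of "k - x"] k[of x] by auto
  with cut_sets_cover[OF P] show "P \<in> ?R" by blast
next
  fix P assume P: "P \<in> ?R"
  then have fld: "x \<in> P \<longleftrightarrow> r x \<in> P" for x by blast
  have "x + m \<in> P \<longleftrightarrow> x \<in> P" "k - x \<in> P \<longleftrightarrow> x \<in> P" for x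
    using fld[of "x + m"] fld[of x] fld[of "k - x"] by (simp_all add: per sym)
  with P show "P \<in> reflective m k" by (simp add: reflective_iff cut_sets_def)
qed

text \<open>The cycle folds at 0 into the path from 0 to h, where h is \<open>m div 2\<close>. For
  even \<open>m\<close> the other fold is at the vertex h and all h + 1 vertices are free; for odd
  \<open>m\<close> the edge between h and h + 1 becomes a loop at h and removes it.\<close>

lemma card_reflective_0:
  assumes "0 < m"
  shows "card (reflective m 0) = fib (nat (m div 2) + (if even m then 3 else 2))"
proof -
  define h where "h = m div 2"
  have mh: "m = 2 * h \<or> m = 2 * h + 1" and h: "0 \<le> h" "even m \<longleftrightarrow> m = 2 * h"
    using assms unfolding h_def by presburger+
  define r where "r x = min (x mod m) (m - x mod m)" for x
  have minus: "(- x) mod m = (if x mod m = 0 then 0 else m - x mod m)" for x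
    by (simp add: zmod_zminus1_eq_if)
  have bnd: "0 \<le> x mod m" "x mod m < m" for x using assms by simp_all
  have r_bnd: "0 \<le> r x" "r x \<le> h" for x
    using bnd[of x] mh by (auto simp: r_def min_def)
  have r_id: "r x = x" if "0 \<le> x" "x \<le> h" for x
  proof -
    have "x < m" using that mh assms by auto
    then have "x mod m = x" using that by simp
    then show ?thesis using that mh by (auto simp: r_def min_def)
  qed
  have range: "range r = {0..h}"
  proof (intro equalityI subsetI)
    fix x assume "x \<in> {0..h}"
    then have "r x = x" using r_id by simp
    then show "x \<in> range r" by (metis rangeI)
  qed (use r_bnd in auto)
  have "reflective m 0 = {P. (\<forall>x. x \<in> P \<longleftrightarrow> r x \<in> P) \<and> (\<forall>x. x \<in> P \<or> x + 1 \<in> P)}"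
  proof (rule reflective_eq_folded)
    show "r x = x mod m \<or> r x = (0 - x) mod m" for x
      using bnd[of x] by (auto simp: r_def minus min_def)
    show "r (0 - x) = r x" for x
      using bnd[of x] by (auto simp: r_def minus min_def)
  qed (simp add: r_def)
  then have "card (reflective m 0) = card {A. A \<subseteq> {0..h} \<and> (\<forall>x. \<not> (r x \<in> A \<and> r (x + 1) \<in> A))}"
    using card_folded_cut_sets[of r] r_id r_bnd by (simp add: range)
  also have "{A. A \<subseteq> {0..h} \<and> (\<forall>x. \<not> (r x \<in> A \<and> r (x + 1) \<in> A))} =
      sparse_subsets 0 (if even m then h + 1 else h)" (is "?L = ?R")
  proof (intro equalityI subsetI)
    fix A assume "A \<in> ?L"
    then have A: "A \<subseteq> {0..h}" "\<And>x. \<not> (r x \<in> A \<and> r (x + 1) \<in> A)" by auto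
    have "\<not> (x \<in> A \<and> x + 1 \<in> A)" for x
    proof
      assume x: "x \<in> A \<and> x + 1 \<in> A"
      then have "0 \<le> x" "x \<le> h" "x + 1 \<le> h" using A(1) by auto
      then show False using A(2)[of x] x by (simp add: r_id)
    qed
    moreover have "x \<in> {0..<(if even m then h + 1 else h)}" if "x \<in> A" for x
    proof (cases "even m")
      case False
      have "r (h + 1) = h"
      proof (cases "h = 0")
        case True
        then show ?thesis using r_bnd[of "h + 1"] by simp
      next
        case F: False
        then have "(h + 1) mod m = h + 1" using False mh h by (intro mod_pos_pos_trivial) auto
        then show ?thesis using False mh h by (auto simp: r_def min_def)
      qed
      then have "h \<notin> A" using A(2)[of h] r_id[of h] h by auto
      then have "x \<noteq> h" "x \<in> {0..h}" using that A(1) by auto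
      with False show ?thesis by auto
    qed (use that A(1) in auto)
    ultimately show "A \<in> ?R" unfolding sparse_subsets_def by blast
  next
    fix A assume "A \<in> ?R"
    then have A: "A \<subseteq> {0..<(if even m then h + 1 else h)}" "\<And>x. \<not> (x \<in> A \<and> x + 1 \<in> A)"
      by (auto simp: sparse_subsets_def)
    have "\<not> (r x \<in> A \<and> r (x + 1) \<in> A)" for x
    proof -
      have "r y = (if y mod m \<le> m - y mod m then y mod m else m - y mod m)" for y
        by (simp add: r_def min_def)
      from this[of x] this[of "x + 1"]
      consider "r (x + 1) = r x + 1" | "r x = r (x + 1) + 1" | "r x = h" "m \<noteq> 2 * h"
        using bnd[of x] add1_mod_int[OF assms, of x] mh by (smt (verit))
      then show ?thesis
      proof cases
        case 3
        then show ?thesis using A(1) h(2) by auto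
      qed (use A(2)[of "r x"] A(2)[of "r (x + 1)"] in auto)
    qed
    moreover have "A \<subseteq> {0..h}" using A(1) by (auto split: if_splits)
    ultimately show "A \<in> ?L" by blast
  qed
  also have "card \<dots> = fib (nat h + (if even m then 3 else 2))"
    using h(1) by (simp add: card_sparse_subsets nat_add_distrib numeral_3_eq_3 numeral_2_eq_2)
  finally show ?thesis by (simp add: h_def)
qed

text \<open>Both folds now go through the middle of an edge, so both ends of the path, 0 and
  \<open>h - 1\<close>, carry loops and only \<open>h - 2\<close> vertices remain free (none when
  \<open>h = 1\<close>).\<close>

lemma card_reflective_minus_1:
  assumes "0 < h"
  shows "card (reflective (2 * int h) (- 1)) = fib h"
proof -
  define m where "m = 2 * int h"
  have m: "0 < m" using assms by (simp add: m_def)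
  define r where "r x = min (x mod m) (m - 1 - x mod m)" for x
  have bnd: "0 \<le> x mod m" "x mod m < m" for x using m by simp_all
  have minus: "(- 1 - x) mod m = m - 1 - x mod m" for x
    using zmod_zminus1_eq_if[of "x + 1" m] add1_mod_int[OF m, of x] bnd[of x] by (simp add: algebra_simps)
  have r_bnd: "0 \<le> r x" "r x < int h" for x
    using bnd[of x] by (auto simp: r_def min_def m_def)
  have r_id: "r x = x" if "0 \<le> x" "x < int h" for x
  proof -
    have "x mod m = x" using that by (intro mod_pos_pos_trivial) (auto simp: m_def)
    then show ?thesis using that by (auto simp: r_def min_def m_def)
  qed
  have range: "range r = {0..<int h}"
  proof (intro equalityI subsetI)
    fix x assume "x \<in> {0..<int h}"
    then have "r x = x" using r_id by simp
    then show "x \<in> range r" by (metis rangeI)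
  qed (use r_bnd in auto)
  have "reflective m (- 1) = {P. (\<forall>x. x \<in> P \<longleftrightarrow> r x \<in> P) \<and> (\<forall>x. x \<in> P \<or> x + 1 \<in> P)}"
  proof (rule reflective_eq_folded)
    show "r x = x mod m \<or> r x = (- 1 - x) mod m" for x
      using bnd[of x] by (auto simp: r_def minus min_def)
    show "r (- 1 - x) = r x" for x
      using bnd[of x] by (auto simp: r_def minus min_def)
  qed (simp add: r_def)
  then have "card (reflective m (- 1)) = card {A. A \<subseteq> {0..<int h} \<and> (\<forall>x. \<not> (r x \<in> A \<and> r (x + 1) \<in> A))}"
    using card_folded_cut_sets[of r] r_id r_bnd by (simp add: range)
  also have "{A. A \<subseteq> {0..<int h} \<and> (\<forall>x. \<not> (r x \<in> A \<and> r (x + 1) \<in> A))} =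
      sparse_subsets 1 (int h - 1)" (is "?L = ?R")
  proof (intro equalityI subsetI)
    fix A assume "A \<in> ?L"
    then have A: "A \<subseteq> {0..<int h}" "\<And>x. \<not> (r x \<in> A \<and> r (x + 1) \<in> A)" by auto
    have "\<not> (x \<in> A \<and> x + 1 \<in> A)" for x
    proof
      assume x: "x \<in> A \<and> x + 1 \<in> A"
      then have "0 \<le> x" "x + 1 < int h" using A(1) by auto
      then show False using A(2)[of x] x by (simp add: r_id)
    qed
    moreover have "x \<in> {1..<int h - 1}" if "x \<in> A" for x
    proof -
      have "r (- 1) = 0" "r 0 = 0" using minus[of 0] m by (auto simp: r_def)
      then have "0 \<notin> A" using A(2)[of "- 1"] by simp
      have "int h mod m = int h" using assms by (intro mod_pos_pos_trivial) (auto simp: m_def)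
      then have "r (int h) = int h - 1" by (auto simp: r_def m_def)
      moreover have "r (int h - 1) = int h - 1" using r_id assms by simp
      ultimately have "int h - 1 \<notin> A" using A(2)[of "int h - 1"] by simp
      with \<open>0 \<notin> A\<close> that A(1) have "x \<noteq> 0" "x \<noteq> int h - 1" "x \<in> {0..<int h}" by auto
      then show ?thesis by auto
    qed
    ultimately show "A \<in> ?R" unfolding sparse_subsets_def by blast
  next
    fix A assume "A \<in> ?R"
    then have A: "A \<subseteq> {1..<int h - 1}" "\<And>x. \<not> (x \<in> A \<and> x + 1 \<in> A)"
      by (auto simp: sparse_subsets_def)
    have "\<not> (r x \<in> A \<and> r (x + 1) \<in> A)" for x
    proof -
      consider "r (x + 1) = r x + 1" | "r x = r (x + 1) + 1" | "r x = int h - 1" | "r x = 0"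
        using bnd[of x] add1_mod_int[OF m, of x] m_def unfolding r_def min_def by (smt (verit))
      then show ?thesis
      proof cases
        case 3
        then show ?thesis using A(1) by auto
      next
        case 4
        then show ?thesis using A(1) by auto
      qed (use A(2)[of "r x"] A(2)[of "r (x + 1)"] in auto)
    qed
    moreover have "A \<subseteq> {0..<int h}" using A(1) by auto
    ultimately show "A \<in> ?L" by blast
  qed
  also have "card \<dots> = fib h"
  proof (cases "h = 1")
    case False
    with assms have "nat (int h - 1 - 1) + 2 = h" by simp
    then show ?thesis by (simp only: card_sparse_subsets)
  qed (simp add: card_sparse_subsets numeral_2_eq_2)
  finally show ?thesis by (simp add: m_def)
qed

text \<open>For odd \<open>m\<close> all reflections are conjugate; for even \<open>m\<close> there
  are two types, each occurring for half of the indices.\<close>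

lemma sum_card_reflective:
  assumes "0 < m"
  shows "(\<Sum>k<m. card (reflective (int m) (int k))) = m * fib (m div 2 + 2)"
proof (cases "even m")
  case True
  then obtain h where h: "m = 2 * h" by (auto elim: evenE)
  with assms have "0 < h" by simp
  have ev: "card (reflective (int m) (2 * int j)) = fib (h + 3)" for j
    using card_reflective_shift[of "int m" 0 "int j"] card_reflective_0[of "int m"] assms h by simp
  have od: "card (reflective (int m) (2 * int j + 1)) = fib h" for j
    using card_reflective_shift[of "int m" "- 1" "int j + 1"] card_reflective_minus_1[OF \<open>0 < h\<close>] h
    by (simp add: algebra_simps)
  have blocks: "(\<Sum>k<2 * l. card (reflective (int m) (int k))) = l * (fib (h + 3) + fib h)" for l
  proof (induction l)
    case (Suc l)
    have "(\<Sum>k<2 * Suc l. card (reflective (int m) (int k))) =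
      (\<Sum>k<2 * l. card (reflective (int m) (int k))) + fib (h + 3) + fib h"
      using ev[of l] od[of l] by (simp add: add.commute)
    with Suc show ?case by simp
  qed simp
  have "(\<Sum>k<m. card (reflective (int m) (int k))) = h * (fib (h + 3) + fib h)"
    using blocks[of h] by (simp only: h)
  \<comment> \<open>The two types average to the count of the odd case.\<close>
  also have "fib (h + 3) + fib h = 2 * fib (h + 2)" by (simp add: numeral_3_eq_3)
  also have "h + 2 = m div 2 + 2" by (simp add: h)
  finally show ?thesis by (simp add: h)
next
  case False
  then obtain h where h: "m = 2 * h + 1" by (auto elim: oddE)
  have "card (reflective (int m) (int k)) = fib (h + 2)" for k
  proof -
    have "card (reflective (int m) (int k)) = card (reflective (int m) 0)"
    proof (cases "even k")
      case True
      then obtain j where "k = 2 * j" by (auto elim: evenE)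
      then show ?thesis using card_reflective_shift[of "int m" 0 "int j"] by simp
    next
      case odd: False
      with False have "even (k + m)" by simp
      then obtain j where "k + m = 2 * j" by (rule evenE)
      then have "int k + int m = 0 + 2 * int j" by linarith
      then show ?thesis
        using card_reflective_shift[of "int m" 0 "int j"] reflective_add_period[of "int m" "int k"] by simp
    qed
    then show ?thesis using card_reflective_0[of "int m"] h by simp
  qed
  moreover have "h + 2 = m div 2 + 2" by (simp add: h)
  ultimately show ?thesis by simp
qed

section \<open>Assembling the two counts\<close>

lemma sum_int_atLeastLessThan: "(\<Sum>k\<in>{0..<int m}. f k) = (\<Sum>k<m. f (int k))"
proof -
  have "{0..<int m} = int ` {..<m}" by (simp add: image_int_atLeastLessThan lessThan_atLeast0)
  then show ?thesis by (simp add: sum.reindex)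
qed

lemma card_necklaces:
  assumes "0 < m"
  shows "m * card (necklace ` cut_sets (int m)) =
    (\<Sum>d | d dvd m. totient (m div d) * (fib (d - 1) + fib (d + 1)))"
proof -
  have "m * card (necklace ` cut_sets (int m)) = (\<Sum>k<m. card (cut_sets (gcd (int k) (int m))))"
    using burnside_necklaces[of "int m" "\<lambda>P. P"] assms
    by (simp add: self_in_necklace fixed_cut_sets sum_int_atLeastLessThan)
  also have "\<dots> = (\<Sum>k<m. fib (gcd k m - 1) + fib (gcd k m + 1))"
  proof (rule sum.cong[OF refl])
    fix k
    have "0 < gcd k m" using assms by simp
    then show "card (cut_sets (gcd (int k) (int m))) = fib (gcd k m - 1) + fib (gcd k m + 1)"
      unfolding gcd_int_int_eq by (rule card_cut_sets)
  qed
  also have "\<dots> = (\<Sum>d | d dvd m. totient (m div d) * (fib (d - 1) + fib (d + 1)))"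
    using assms by (rule sum_gcd_eq_sum_divisors)
  finally show ?thesis .
qed

lemma card_achiral_necklaces:
  assumes "0 < m"
  shows "card (necklace ` {P \<in> cut_sets (int m). negate P \<in> necklace P}) = fib (m div 2 + 2)"
proof -
  have inv: "negate Q \<in> necklace Q" if "Q \<in> necklace P" "negate P \<in> necklace P" for P Q :: "int set"
  proof -
    obtain j k where "Q = translate j P" "negate P = translate k P"
      using \<open>Q \<in> necklace P\<close> \<open>negate P \<in> necklace P\<close> by (auto simp: necklace_def)
    then have "negate Q = translate (k - 2 * j) Q" by (simp add: negate_translate)
    then show ?thesis by (simp add: necklace_def)
  qed
  have "m * card (necklace ` {P \<in> cut_sets (int m). negate P \<in> necklace P}) =
      (\<Sum>k<m. card (reflective (int m) (int k)))"
    using burnside_necklaces[of "int m" negate] inv assms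
    by (simp add: reflective_def sum_int_atLeastLessThan)
  also have "\<dots> = m * fib (m div 2 + 2)" using assms by (rule sum_card_reflective)
  finally show ?thesis using assms by simp
qed

text \<open>Transfers counts from necklaces to toggle orbits, which are known only to identify the
  same pairs of cut sets.\<close>

lemma card_image_cong_kernel:
  assumes "\<And>x y. x \<in> A \<Longrightarrow> y \<in> A \<Longrightarrow> f x = f y \<longleftrightarrow> g x = g y"
  shows "card (f ` A) = card (g ` A)"
proof (rule bij_betw_same_card)
  show "bij_betw (\<lambda>y. g (inv_into A f y)) (f ` A) (g ` A)"
  proof (rule bij_betwI')
    fix y z assume "y \<in> f ` A" "z \<in> f ` A"
    then show "g (inv_into A f y) = g (inv_into A f z) \<longleftrightarrow> y = z"
      using assms[of "inv_into A f y" "inv_into A f z"] by (simp add: inv_into_into f_inv_into_f)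
  next
    fix y assume "y \<in> f ` A"
    then show "g (inv_into A f y) \<in> g ` A" by (simp add: inv_into_into)
  next
    fix z assume "z \<in> g ` A"
    then obtain x where x: "x \<in> A" "z = g x" by blast
    then have "g (inv_into A f (f x)) = z"
      using assms[of "inv_into A f (f x)" x] by (simp add: inv_into_into f_inv_into_f)
    with x(1) show "\<exists>y\<in>f ` A. z = g (inv_into A f y)" by (intro bexI[of _ "f x"]) simp_all
  qed
qed

theorem theorem3p13:
  fixes n :: nat
  assumes "n \<ge> 2"
  shows "real (card (phi_orbits n)) =
           1 / real (n - 1) *
           (\<Sum>d | d dvd n - 1. real (totient ((n - 1) div d)) * real (fib (d - 1) + fib (d + 1)))
         \<and> card {A \<in> phi_orbits n. reversible n A} = fib (nat \<lceil>real n / 2\<rceil> + 1)"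
proof
  define m where "m = n - 1"
  have m: "0 < m" and n: "n = m + 1" using assms by (auto simp: m_def)
  have card_eq: "card (board_orbit m ` G) = card (necklace ` G)" if "G \<subseteq> cut_sets (int m)" for G
    using that board_orbit_eq_iff[OF _ _ m] by (intro card_image_cong_kernel) blast
  have orbits: "phi_orbits n = board_orbit m ` cut_sets (int m)"
    unfolding n by (rule phi_orbits_eq[OF m])
  have "m * card (phi_orbits n) = (\<Sum>d | d dvd m. totient (m div d) * (fib (d - 1) + fib (d + 1)))"
    unfolding orbits card_eq[OF subset_refl] by (rule card_necklaces[OF m])
  then have "real m * real (card (phi_orbits n)) =
      (\<Sum>d | d dvd m. real (totient (m div d)) * real (fib (d - 1) + fib (d + 1)))"
    unfolding of_nat_mult[symmetric] of_nat_sum[symmetric] by simp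
  then show "real (card (phi_orbits n)) =
      1 / real (n - 1) *
      (\<Sum>d | d dvd n - 1. real (totient ((n - 1) div d)) * real (fib (d - 1) + fib (d + 1)))"
    unfolding m_def[symmetric] using m by (simp add: field_simps)
  have "{A \<in> phi_orbits n. reversible n A} =
      board_orbit m ` {P \<in> cut_sets (int m). negate P \<in> necklace P}"
    unfolding orbits using reversible_board_orbit_iff[OF _ m] by (auto simp: n)
  then have "card {A \<in> phi_orbits n. reversible n A} = fib (m div 2 + 2)"
    using card_eq[of "{P \<in> cut_sets (int m). negate P \<in> necklace P}"] card_achiral_necklaces[OF m] by auto
  moreover have "nat \<lceil>real n / 2\<rceil> + 1 = m div 2 + 2"
  proof (cases "even n")
    case True
    then obtain h where h: "n = 2 * h" by (auto elim: evenE)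
    with assms obtain g where "h = Suc g" by (cases h) auto
    moreover from h have "nat \<lceil>real n / 2\<rceil> = h" by simp
    ultimately show ?thesis by (simp add: m_def h)
  next
    case False
    then obtain h where h: "n = 2 * h + 1" by (auto elim: oddE)
    have "\<lceil>real n / 2\<rceil> = int (h + 1)" by (rule ceiling_unique) (auto simp: h)
    then have "nat \<lceil>real n / 2\<rceil> = h + 1" by simp
    with h show ?thesis by (simp add: m_def)
  qed
  ultimately show "card {A \<in> phi_orbits n. reversible n A} = fib (nat \<lceil>real n / 2\<rceil> + 1)"
    by simp
qed

end
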